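(* Let $G$ be a countable linear sofic group. Then there exist a non-principal ultrafilter $\omega$ on $\mathbb{N}$, a sequence $n_k\to\infty$ and an injective group morphism $\Theta:G\to\prod_{k\to\omega}GL_{n_k}(\mathbb{Q})/d_\omega$.
   Context: For a field $F$ and $a\in M_n(F)$, $\rho(a)=\operatorname{rk}(a)/n$. $\prod_{k\to\omega}GL_{n_k}(F)/d_\omega$ is the quotient of $\prod_kGL_{n_k}(F)$ by $\{(a_k)_k:\lim_{k\to\omega}\rho(a_k-\mathrm{Id})=0\}$. A countable group is linear sofic if it admits an injective group morphism into $\prod_{k\to\omega}GL_{n_k}(\mathbb{C})/d_\omega$ for some non-principal ultrafilter $\omega$ and $n_k\to\infty$. *)

theory Defs
  imports "HOL-Analysis.Analysis" "HOL-Algebra.Coset" "Jordan_Normal_Form.DL_Rank"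
begin

definition nrank :: "nat \<Rightarrow> 'a::field mat \<Rightarrow> real" where
  "nrank n a = real (vec_space.rank n a) / real n"

definition GL_set :: "'a::field itself \<Rightarrow> nat \<Rightarrow> 'a mat set" where
  "GL_set T n = {a \<in> carrier_mat n n. invertible_mat a}"

definition GL_prod :: "'a::field itself \<Rightarrow> (nat \<Rightarrow> nat) \<Rightarrow> (nat \<Rightarrow> 'a mat) monoid" where
  "GL_prod T ns = \<lparr> carrier = {a. \<forall>k. a k \<in> GL_set T (ns k)},
                   mult = (\<lambda>a b k. a k * b k),
                   one = (\<lambda>k. 1\<^sub>m (ns k)) \<rparr>"

definition GL_null :: "'a::field itself \<Rightarrow> nat filter \<Rightarrow> (nat \<Rightarrow> nat) \<Rightarrow> (nat \<Rightarrow> 'a mat) set" where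
  "GL_null T \<omega> ns = {a \<in> carrier (GL_prod T ns).
      ((\<lambda>k. nrank (ns k) (a k - 1\<^sub>m (ns k))) \<longlongrightarrow> 0) \<omega>}"

definition GL_ultra :: "'a::field itself \<Rightarrow> nat filter \<Rightarrow> (nat \<Rightarrow> nat) \<Rightarrow> (nat \<Rightarrow> 'a mat) set monoid" where
  "GL_ultra T \<omega> ns = GL_prod T ns Mod GL_null T \<omega> ns"

definition ultrafilter :: "nat filter \<Rightarrow> bool" where
  "ultrafilter F \<longleftrightarrow> F \<noteq> bot \<and> (\<forall>P. eventually P F \<or> eventually (\<lambda>x. \<not> P x) F)"

definition nonprincipal_ultrafilter :: "nat filter \<Rightarrow> bool" where
  "nonprincipal_ultrafilter F \<longleftrightarrow> ultrafilter F \<and> F \<le> cofinite"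

definition linear_sofic :: "('g, 'b) monoid_scheme \<Rightarrow> bool" where
  "linear_sofic G \<longleftrightarrow> (\<exists>\<omega> ns \<Theta>. nonprincipal_ultrafilter \<omega> \<and> filterlim ns at_top sequentially
      \<and> \<Theta> \<in> hom G (GL_ultra TYPE(complex) \<omega> ns) \<and> inj_on \<Theta> (carrier G))"

end

(*
  Finitely many complex numbers lie in a subring R of the complex numbers with a unital ring
  homomorphism R -> M_d(Q), d > 0.  To see this, adjoin them to Q one at a time: a transcendental
  element is specialised to a natural number, an algebraic one acts by its regular representation.
  Replacing each entry of a matrix by its d x d image multiplies the rank by d, provided R also
  contains the entries of matrices with A = L U and P A Q = 1, of inner size rk A; hence rk/n is
  preserved.  At level k this is applied to the finitely many matrices that matter for the first k
  elements of G, so the ultrafilter is kept and n_k is replaced by n_k d_k.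
*)

theory Submission
  imports Defs
begin

section \<open>Matrix representations of subrings\<close>

text \<open>A unital homomorphism from a field to M_d(Q) with d > 0 is injective, so a field of
  infinite degree over Q has none. Hence the domain \<open>R\<close> is only a subring, chosen after
  the finite set at hand, and the induction carries the property \<open>locally_rational\<close> of
  a subfield instead of one fixed representation. The price is a possible kernel: specialising a
  transcendental s to z kills s - z, and a matrix could lose rank. Rank is therefore certified by
  identities, A = L U for the upper bound and P A Q = 1 for the lower one, which every unital ring
  homomorphism on the entries preserves. Invertibility is carried over in the same way, with the
  entries of the inverse placed in \<open>R\<close>. The morphism law and injectivity in the
  ultraproduct speak only of limits of normalised ranks of differences, and for fixed group elements
  these ranks are unchanged at all but finitely many levels.\<close>

definition is_subring :: "'a::comm_ring_1 set \<Rightarrow> bool" where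
  "is_subring R \<longleftrightarrow> 1 \<in> R \<and> (\<forall>x\<in>R. \<forall>y\<in>R. x - y \<in> R \<and> x * y \<in> R)"

lemma is_subringD:
  assumes "is_subring R"
  shows is_subring_1: "1 \<in> R"
    and is_subring_diff: "x \<in> R \<Longrightarrow> y \<in> R \<Longrightarrow> x - y \<in> R"
    and is_subring_mult: "x \<in> R \<Longrightarrow> y \<in> R \<Longrightarrow> x * y \<in> R"
    and is_subring_0: "0 \<in> R"
    and is_subring_uminus: "x \<in> R \<Longrightarrow> - x \<in> R"
    and is_subring_add: "x \<in> R \<Longrightarrow> y \<in> R \<Longrightarrow> x + y \<in> R"
    and is_subring_power: "x \<in> R \<Longrightarrow> x ^ n \<in> R"
    and is_subring_sum: "(\<And>i. i \<in> I \<Longrightarrow> f i \<in> R) \<Longrightarrow> sum f I \<in> R"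
proof -
  show one: "1 \<in> R" and diff: "x \<in> R \<Longrightarrow> y \<in> R \<Longrightarrow> x - y \<in> R"
    and mult: "x \<in> R \<Longrightarrow> y \<in> R \<Longrightarrow> x * y \<in> R" for x y
    using assms by (auto simp: is_subring_def)
  show zero: "0 \<in> R" using diff[OF one one] by simp
  show um: "- x \<in> R" if "x \<in> R" for x using diff[OF zero that] by simp
  show add: "x + y \<in> R" if "x \<in> R" "y \<in> R" for x y using diff[OF that(1) um[OF that(2)]] by simp
  show "x \<in> R \<Longrightarrow> x ^ n \<in> R" by (induction n) (auto intro: one mult)
  show "sum f I \<in> R" if "\<And>i. i \<in> I \<Longrightarrow> f i \<in> R" using that
    by (induction I rule: infinite_finite_induct) (auto intro: zero add)
qed

text \<open>Values of \<open>\<phi>\<close> outside \<open>R\<close> are arbitrary, and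
  \<open>\<phi>\<close> may have a kernel on \<open>R\<close>. Positivity of \<open>d\<close> lets
  the factor \<open>d\<close> cancel in normalised ranks and keeps the new matrix sizes tending to
  infinity.\<close>

definition mat_rep :: "'a::comm_ring_1 set \<Rightarrow> nat \<Rightarrow> ('a \<Rightarrow> 'b::comm_ring_1 mat) \<Rightarrow> bool" where
  "mat_rep R d \<phi> \<longleftrightarrow> is_subring R \<and> 0 < d \<and> \<phi> 1 = 1\<^sub>m d \<and> (\<forall>x\<in>R. \<phi> x \<in> carrier_mat d d)
     \<and> (\<forall>x\<in>R. \<forall>y\<in>R. \<phi> (x + y) = \<phi> x + \<phi> y \<and> \<phi> (x * y) = \<phi> x * \<phi> y)"

text \<open>The identification of n x m matrices over M_d with nd x md matrices:
  \<open>div d\<close> picks the block, \<open>mod d\<close> the position inside it.\<close>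

definition block_mat :: "('a \<Rightarrow> 'b mat) \<Rightarrow> nat \<Rightarrow> 'a mat \<Rightarrow> 'b mat" where
  "block_mat \<phi> d A = mat (dim_row A * d) (dim_col A * d)
     (\<lambda>(i,j). \<phi> (A $$ (i div d, j div d)) $$ (i mod d, j mod d))"

lemma block_mat_carrier: "A \<in> carrier_mat n m \<Longrightarrow> block_mat \<phi> d A \<in> carrier_mat (n * d) (m * d)"
  by (auto simp: block_mat_def)

definition mat_over :: "'a set \<Rightarrow> nat \<Rightarrow> nat \<Rightarrow> 'a mat set" where
  "mat_over R n m = {A \<in> carrier_mat n m. elements_mat A \<subseteq> R}"

lemma mat_overI: "A \<in> carrier_mat n m \<Longrightarrow> (\<And>i j. i < n \<Longrightarrow> j < m \<Longrightarrow> A $$ (i,j) \<in> R) \<Longrightarrow> A \<in> mat_over R n m"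
  by (auto simp: mat_over_def elements_mat_def)

lemma mat_overD: "A \<in> mat_over R n m \<Longrightarrow> A \<in> carrier_mat n m"
    "A \<in> mat_over R n m \<Longrightarrow> i < n \<Longrightarrow> j < m \<Longrightarrow> A $$ (i,j) \<in> R"
  unfolding mat_over_def by blast+

lemma one_mat_over: "is_subring R \<Longrightarrow> 1\<^sub>m n \<in> mat_over R n n"
  by (rule mat_overI) (auto intro: is_subring_0 is_subring_1)

lemma mult_mat_over:
  assumes "is_subring R" "A \<in> mat_over R n m" "B \<in> mat_over R m l"
  shows "A * B \<in> mat_over R n l"
proof (rule mat_overI)
  note c = mat_overD(1)[OF assms(2)] mat_overD(1)[OF assms(3)]
  show "A * B \<in> carrier_mat n l" using c by auto
  fix i j assume "i < n" "j < l"
  then show "(A * B) $$ (i,j) \<in> R" using c mat_overD(2)[OF assms(2)] mat_overD(2)[OF assms(3)]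
    by (auto simp: scalar_prod_def intro!: is_subring_sum[OF assms(1)] is_subring_mult[OF assms(1)])
qed

lemma div_mod_less:
  fixes i :: nat assumes "i < n * d"
  shows "i div d < n" "i mod d < d" "0 < d"
proof -
  show "0 < d" using assms by (cases d) auto
  then show "i div d < n" "i mod d < d" using assms by (auto simp: less_mult_imp_div_less)
qed

text \<open>Cutting \<open>{..<n * d}\<close> into \<open>n\<close> intervals of length
  \<open>d\<close> matches the inner sum of a product of block matrices with a sum over blocks and
  positions.\<close>

lemma sum_div_mod:
  fixes f :: "nat \<Rightarrow> nat \<Rightarrow> 'a::comm_monoid_add"
  shows "(\<Sum>k<n * d. f (k div d) (k mod d)) = (\<Sum>i<n. \<Sum>j<d. f i j)"
proof -
  have "sum (\<lambda>k. f (k div d) (k mod d)) {i * d..<i * d + d} = (\<Sum>j<d. f i j)" for i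
    by (subst sum.atLeastLessThan_shift_0) (auto simp: atLeast0LessThan intro!: sum.cong)
  then show ?thesis by (simp add: sum.nat_group[symmetric])
qed

section \<open>Calculus of a fixed representation and of its block matrices\<close>

context
  fixes R d and \<phi> :: "'a::comm_ring_1 \<Rightarrow> 'b::comm_ring_1 mat"
  assumes rep: "mat_rep R d \<phi>"
begin

lemma mat_rep_subring: "is_subring R" and mat_rep_pos: "0 < d" and mat_rep_one: "\<phi> 1 = 1\<^sub>m d"
  and mat_rep_carrier: "x \<in> R \<Longrightarrow> \<phi> x \<in> carrier_mat d d"
  and mat_rep_add: "x \<in> R \<Longrightarrow> y \<in> R \<Longrightarrow> \<phi> (x + y) = \<phi> x + \<phi> y"
  and mat_rep_mult: "x \<in> R \<Longrightarrow> y \<in> R \<Longrightarrow> \<phi> (x * y) = \<phi> x * \<phi> y"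
  using rep by (auto simp: mat_rep_def)

lemma mat_rep_zero: "\<phi> 0 = 0\<^sub>m d d"
proof -
  note z = is_subring_0[OF mat_rep_subring]
  note c = mat_rep_carrier[OF z]
  have "\<phi> 0 = \<phi> 0 + \<phi> 0" using mat_rep_add[OF z z] by simp
  then have "\<phi> 0 $$ (i,j) = \<phi> 0 $$ (i,j) + \<phi> 0 $$ (i,j)" if "i < d" "j < d" for i j
    using that c by (metis carrier_matD index_add_mat(1))
  then show ?thesis using c by (intro eq_matI) auto
qed

lemma mat_rep_add_index: "x \<in> R \<Longrightarrow> y \<in> R \<Longrightarrow> i < d \<Longrightarrow> j < d \<Longrightarrow>
    \<phi> (x + y) $$ (i,j) = \<phi> x $$ (i,j) + \<phi> y $$ (i,j)"
  using mat_rep_carrier[of x] mat_rep_carrier[of y] by (auto simp: mat_rep_add)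

lemma mat_rep_diff_index:
  assumes "x \<in> R" "y \<in> R" "i < d" "j < d"
  shows "\<phi> (x - y) $$ (i,j) = \<phi> x $$ (i,j) - \<phi> y $$ (i,j)"
  using mat_rep_add_index[of "x - y" y i j] is_subring_diff[OF mat_rep_subring] assms by auto

lemma mat_rep_sum_index:
  assumes "\<And>k. k \<in> I \<Longrightarrow> f k \<in> R" "i < d" "j < d"
  shows "\<phi> (sum f I) $$ (i,j) = (\<Sum>k\<in>I. \<phi> (f k) $$ (i,j))"
  using assms(1)
  by (induction I rule: infinite_finite_induct)
    (use assms in \<open>auto simp: mat_rep_zero mat_rep_add_index is_subring_sum[OF mat_rep_subring]\<close>)

lemma mat_rep_mult_index:
  assumes "x \<in> R" "y \<in> R" "i < d" "j < d"
  shows "\<phi> (x * y) $$ (i,j) = (\<Sum>k<d. \<phi> x $$ (i,k) * \<phi> y $$ (k,j))"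
  using assms mat_rep_carrier[of x] mat_rep_carrier[of y]
  by (auto simp: mat_rep_mult scalar_prod_def atLeast0LessThan)

lemma block_mat_mult:
  assumes A: "A \<in> mat_over R n m" and B: "B \<in> mat_over R m l"
  shows "block_mat \<phi> d (A * B) = block_mat \<phi> d A * block_mat \<phi> d B"
proof (rule eq_matI)
  note c = mat_overD(1)[OF A] mat_overD(1)[OF B]
  note dims = carrier_matD[OF c(1)] carrier_matD[OF c(2)]
  fix i j assume "i < dim_row (block_mat \<phi> d A * block_mat \<phi> d B)"
    and "j < dim_col (block_mat \<phi> d A * block_mat \<phi> d B)"
  then have ij: "i < n * d" "j < l * d" using c by (auto simp: block_mat_def)
  note i = div_mod_less[OF ij(1)] and j = div_mod_less[OF ij(2)]
  let ?a = "\<lambda>k r. \<phi> (A $$ (i div d, k)) $$ (i mod d, r)"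
  let ?b = "\<lambda>k r. \<phi> (B $$ (k, j div d)) $$ (r, j mod d)"
  have mem: "A $$ (i div d, k) \<in> R" "B $$ (k, j div d) \<in> R" if "k < m" for k
    using that i j mat_overD(2)[OF A] mat_overD(2)[OF B] by auto
  have "block_mat \<phi> d (A * B) $$ (i,j)
      = \<phi> (\<Sum>k<m. A $$ (i div d, k) * B $$ (k, j div d)) $$ (i mod d, j mod d)"
    using ij i j dims by (simp add: block_mat_def scalar_prod_def atLeast0LessThan)
  also have "\<dots> = (\<Sum>k<m. \<Sum>r<d. ?a k r * ?b k r)"
    using i j mem
    by (subst mat_rep_sum_index)
      (auto intro!: sum.cong is_subring_mult[OF mat_rep_subring] simp: mat_rep_mult_index)
  also have "\<dots> = (\<Sum>k<m * d. ?a (k div d) (k mod d) * ?b (k div d) (k mod d))"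
    by (rule sum_div_mod[symmetric])
  also have "\<dots> = (block_mat \<phi> d A * block_mat \<phi> d B) $$ (i,j)"
    using ij dims by (simp add: block_mat_def scalar_prod_def atLeast0LessThan)
  finally show "block_mat \<phi> d (A * B) $$ (i,j) = (block_mat \<phi> d A * block_mat \<phi> d B) $$ (i,j)" .
qed (auto simp: block_mat_def)

lemma block_mat_add:
  assumes A: "A \<in> mat_over R n m" and B: "B \<in> mat_over R n m"
  shows "block_mat \<phi> d (A + B) = block_mat \<phi> d A + block_mat \<phi> d B"
  using mat_overD(1)[OF A] mat_overD(1)[OF B] mat_overD(2)[OF A] mat_overD(2)[OF B]
  by (intro eq_matI)
    (auto simp: block_mat_def mat_rep_add_index div_mod_less)

lemma block_mat_diff:
  assumes A: "A \<in> mat_over R n m" and B: "B \<in> mat_over R n m"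
  shows "block_mat \<phi> d (A - B) = block_mat \<phi> d A - block_mat \<phi> d B"
  using mat_overD(1)[OF A] mat_overD(1)[OF B] mat_overD(2)[OF A] mat_overD(2)[OF B]
  by (intro eq_matI)
    (auto simp: block_mat_def mat_rep_diff_index div_mod_less)

lemma block_mat_one: "block_mat \<phi> d (1\<^sub>m n) = 1\<^sub>m (n * d)"
proof (rule eq_matI)
  fix i j assume "i < dim_row (1\<^sub>m (n * d))" "j < dim_col (1\<^sub>m (n * d))"
  then have ij: "i < n * d" "j < n * d" by auto
  have "i = j \<longleftrightarrow> i div d = j div d \<and> i mod d = j mod d"
    by (metis div_mult_mod_eq)
  then show "block_mat \<phi> d (1\<^sub>m n) $$ (i, j) = 1\<^sub>m (n * d) $$ (i, j)"
    using ij div_mod_less[OF ij(1)] div_mod_less[OF ij(2)]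
    by (auto simp: block_mat_def mat_rep_one mat_rep_zero)
qed (auto simp: block_mat_def)

end

section \<open>Representations of finitely generated fields over the rationals\<close>

definition is_subfield :: "'a::field set \<Rightarrow> bool" where
  "is_subfield F \<longleftrightarrow> is_subring F \<and> (\<forall>x\<in>F. inverse x \<in> F)"

lemma is_subfieldD:
  assumes "is_subfield F"
  shows is_subfield_subring: "is_subring F"
    and is_subfield_inverse: "x \<in> F \<Longrightarrow> inverse x \<in> F"
    and is_subfield_divide: "x \<in> F \<Longrightarrow> y \<in> F \<Longrightarrow> x / y \<in> F"
  using assms by (auto simp: is_subfield_def divide_inverse is_subring_mult)

text \<open>The quantifier order matters: \<open>R\<close>, \<open>d\<close> and
  \<open>\<phi>\<close> all depend on the finite set \<open>X\<close>.\<close>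

definition locally_rational :: "'a::comm_ring_1 set \<Rightarrow> bool" where
  "locally_rational F \<longleftrightarrow>
     (\<forall>X. finite X \<and> X \<subseteq> F \<longrightarrow> (\<exists>R d (\<phi> :: 'a \<Rightarrow> rat mat). X \<subseteq> R \<and> mat_rep R d \<phi>))"

text \<open>Composition of S -> M_e(R) with M_e(R) -> M_ed. Since \<open>\<phi>\<close> is
  controlled on \<open>R\<close> only, the domain shrinks to the elements whose matrices have all
  entries in \<open>R\<close>.\<close>

lemma mat_rep_block:
  fixes \<rho> :: "'a::comm_ring_1 \<Rightarrow> 'b::comm_ring_1 mat" and \<phi> :: "'b \<Rightarrow> 'c::comm_ring_1 mat"
  assumes \<rho>: "mat_rep S e \<rho>" and \<phi>: "mat_rep R d \<phi>"
  shows "mat_rep {x \<in> S. \<rho> x \<in> mat_over R e e} (e * d) (\<lambda>x. block_mat \<phi> d (\<rho> x))"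
proof -
  note R = mat_rep_subring[OF \<phi>] and S = mat_rep_subring[OF \<rho>]
  have diff: "\<rho> (x - y) \<in> mat_over R e e"
    if "x \<in> S" "y \<in> S" "\<rho> x \<in> mat_over R e e" "\<rho> y \<in> mat_over R e e" for x y
    using that mat_rep_carrier[OF \<rho> is_subring_diff[OF S]]
    by (intro mat_overI) (auto simp: mat_rep_diff_index[OF \<rho>] intro!: is_subring_diff[OF R] dest: mat_overD(2))
  have "is_subring {x \<in> S. \<rho> x \<in> mat_over R e e}"
    unfolding is_subring_def
    using diff
    by (auto simp: mat_rep_one[OF \<rho>] mat_rep_mult[OF \<rho>]
        intro!: one_mat_over mult_mat_over[OF R] R is_subring_1[OF S] is_subring_diff[OF S]
          is_subring_mult[OF S])
  then show ?thesis
    unfolding mat_rep_def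
    using mat_rep_pos[OF \<rho>] mat_rep_pos[OF \<phi>]
    by (auto simp: mat_rep_one[OF \<rho>] mat_rep_mult[OF \<rho>] mat_rep_add[OF \<rho>] block_mat_one[OF \<phi>]
        block_mat_mult[OF \<phi>] block_mat_add[OF \<phi>] intro!: block_mat_carrier dest: mat_overD(1))
qed

text \<open>The induction step in general form: represent \<open>X\<close> by matrices over
  \<open>F\<close>, apply local rationality of \<open>F\<close> to the finitely many entries of
  these matrices, and compose.\<close>

lemma locally_rational_transfer:
  fixes F K :: "'a::comm_ring_1 set"
  assumes F: "locally_rational F"
    and K: "\<And>X. finite X \<Longrightarrow> X \<subseteq> K \<Longrightarrow>
      \<exists>S e (\<rho> :: 'a \<Rightarrow> 'a mat). X \<subseteq> S \<and> mat_rep S e \<rho> \<and> (\<forall>x\<in>S. \<rho> x \<in> mat_over F e e)"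
  shows "locally_rational K"
  unfolding locally_rational_def
proof (intro allI impI)
  fix X assume X: "finite X \<and> X \<subseteq> K"
  obtain S e and \<rho> :: "'a \<Rightarrow> 'a mat"
    where S: "X \<subseteq> S" "mat_rep S e \<rho>" "\<forall>x\<in>S. \<rho> x \<in> mat_over F e e"
    using K[of X] X by metis
  let ?Y = "\<Union>x\<in>X. elements_mat (\<rho> x)"
  have "elements_mat (\<rho> x) \<subseteq> F" if "x \<in> X" for x
    using S that by (auto simp: mat_over_def)
  then have "finite ?Y \<and> ?Y \<subseteq> F" using X by (auto simp: elements_mat_def)
  then have "\<exists>R d (\<phi> :: 'a \<Rightarrow> rat mat). ?Y \<subseteq> R \<and> mat_rep R d \<phi>"
    by (rule F[unfolded locally_rational_def, rule_format])
  then obtain R d and \<phi> :: "'a \<Rightarrow> rat mat" where R: "?Y \<subseteq> R" "mat_rep R d \<phi>"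
    by (elim exE conjE)
  have "X \<subseteq> {x \<in> S. \<rho> x \<in> mat_over R e e}"
  proof
    fix x assume x: "x \<in> X"
    then have "elements_mat (\<rho> x) \<subseteq> R" using R(1) by (meson UN_subset_iff)
    then show "x \<in> {x \<in> S. \<rho> x \<in> mat_over R e e}"
      using x S(1) mat_rep_carrier[OF S(2)] by (simp add: mat_over_def subset_iff)
  qed
  with mat_rep_block[OF S(2) R(2)]
  show "\<exists>R d (\<phi> :: 'a \<Rightarrow> rat mat). X \<subseteq> R \<and> mat_rep R d \<phi>" by blast
qed

lemma mat_rep_scalar:
  assumes "is_subring S" and "f 1 = 1"
    and "\<And>x y. x \<in> S \<Longrightarrow> y \<in> S \<Longrightarrow> f (x + y) = f x + f y"
    and "\<And>x y. x \<in> S \<Longrightarrow> y \<in> S \<Longrightarrow> f (x * y) = f x * f y"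
  shows "mat_rep S 1 (\<lambda>x. mat 1 1 (\<lambda>_. f x))"
  using assms by (auto simp: mat_rep_def scalar_prod_def intro!: eq_matI)

lemma is_subring_Rats: "is_subring (\<rat> :: 'a::field_char_0 set)"
  by (auto simp: is_subring_def)

text \<open>Base case of the induction: the inverse of \<open>of_rat\<close> is a one-dimensional
  representation of all of \<open>\<rat>\<close>, so the same one serves for every
  \<open>X\<close>.\<close>

lemma locally_rational_Rats: "locally_rational (\<rat> :: 'a::field_char_0 set)"
proof -
  let ?f = "the_inv of_rat :: 'a \<Rightarrow> rat"
  have f: "?f (of_rat r) = r" for r by (rule the_inv_f_f) (simp add: inj_def)
  have 1: "?f 1 = 1" using f[of 1] by simp
  have "?f (x + y) = ?f x + ?f y" "?f (x * y) = ?f x * ?f y" if xy: "x \<in> \<rat>" "y \<in> \<rat>" for x y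
  proof -
    obtain a b where ab: "x = of_rat a" "y = of_rat b" using xy by (auto elim!: Rats_cases)
    show "?f (x + y) = ?f x + ?f y" "?f (x * y) = ?f x * ?f y"
      unfolding ab of_rat_add[symmetric] of_rat_mult[symmetric] f by simp_all
  qed
  then have "mat_rep \<rat> 1 (\<lambda>x. mat 1 1 (\<lambda>_. ?f x))"
    using mat_rep_scalar[OF is_subring_Rats, of ?f] 1 by simp
  then show ?thesis unfolding locally_rational_def by blast
qed

section \<open>Polynomials over a subring and the simple extension F(s)\<close>

definition polys_over :: "'a::zero set \<Rightarrow> 'a poly set" where
  "polys_over F = {p. \<forall>i. coeff p i \<in> F}"

lemma polys_overD: "p \<in> polys_over F \<Longrightarrow> coeff p i \<in> F"
  by (auto simp: polys_over_def)

lemma is_subring_polys_over: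
  assumes F: "is_subring F" shows "is_subring (polys_over F)"
  unfolding is_subring_def polys_over_def
  by (auto simp: coeff_mult coeff_1 intro!: is_subring_1 is_subring_0 is_subring_sum is_subring_diff
        is_subring_mult F)

lemma poly_in_subring:
  assumes F: "is_subring F" and "p \<in> polys_over F" "x \<in> F"
  shows "poly p x \<in> F"
  using assms(2,3) unfolding poly_altdef
  by (auto intro!: is_subring_sum is_subring_mult is_subring_power F dest: polys_overD)

lemma pCons_polys_over:
  assumes "a \<in> F" "p \<in> polys_over F" shows "pCons a p \<in> polys_over F"
  using assms by (auto simp: polys_over_def coeff_pCons split: nat.split)

lemma polys_over_pConsD:
  assumes "pCons a p \<in> polys_over F" shows "a \<in> F" "p \<in> polys_over F"
proof -
  show "a \<in> F" using polys_overD[OF assms, of 0] by simp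
  show "p \<in> polys_over F" using polys_overD[OF assms, of "Suc _"] by (auto simp: polys_over_def)
qed

lemma smult_polys_over:
  assumes "is_subring F" "a \<in> F" "p \<in> polys_over F" shows "Polynomial.smult a p \<in> polys_over F"
  using assms by (auto simp: polys_over_def is_subring_mult)

lemma const_polys_over:
  assumes "is_subring F" "a \<in> F" shows "[:a:] \<in> polys_over F"
  using assms by (intro pCons_polys_over is_subring_0[OF is_subring_polys_over])

text \<open>This is F(s). Fractions of values at \<open>s\<close> cover the algebraic and the
  transcendental case by one formula.\<close>

definition adjoin :: "'a::field set \<Rightarrow> 'a \<Rightarrow> 'a set" where
  "adjoin F s = {poly p s / poly q s | p q. p \<in> polys_over F \<and> q \<in> polys_over F \<and> poly q s \<noteq> 0}"

lemma adjoinI: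
  "p \<in> polys_over F \<Longrightarrow> q \<in> polys_over F \<Longrightarrow> poly q s \<noteq> 0 \<Longrightarrow> x = poly p s / poly q s \<Longrightarrow> x \<in> adjoin F s"
  by (auto simp: adjoin_def)

lemma is_subfield_adjoin:
  assumes F: "is_subring F" shows "is_subfield (adjoin F s)"
proof -
  note P = is_subring_polys_over[OF F]
  have 1: "1 \<in> adjoin F s"
    using is_subring_1[OF P] by (intro adjoinI[of 1 F 1]) auto
  have "x - y \<in> adjoin F s \<and> x * y \<in> adjoin F s" if xy: "x \<in> adjoin F s" "y \<in> adjoin F s" for x y
  proof -
    obtain p q p' q' where pq: "p \<in> polys_over F" "q \<in> polys_over F" "poly q s \<noteq> 0" "x = poly p s / poly q s"
      "p' \<in> polys_over F" "q' \<in> polys_over F" "poly q' s \<noteq> 0" "y = poly p' s / poly q' s"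
      using xy by (auto simp: adjoin_def)
    have "x - y \<in> adjoin F s"
      using pq(1-3,5-7) unfolding pq(4,8)
      by (intro adjoinI[of "p * q' - p' * q" _ "q * q'"])
        (auto intro!: is_subring_diff is_subring_mult P simp: diff_frac_eq)
    moreover have "x * y \<in> adjoin F s"
      by (rule adjoinI[of "p * p'" _ "q * q'"])
        (use pq in \<open>auto intro!: is_subring_mult P\<close>)
    ultimately show ?thesis by simp
  qed
  moreover have "inverse x \<in> adjoin F s" if x: "x \<in> adjoin F s" for x
  proof (cases "x = 0")
    case False
    then show ?thesis using x by (auto simp: adjoin_def) metis
  qed (use x in simp)
  ultimately show ?thesis using 1 by (auto simp: is_subfield_def is_subring_def)
qed

lemma subset_adjoin:
  assumes F: "is_subring F" shows "F \<subseteq> adjoin F s" "s \<in> adjoin F s"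
proof -
  note P = is_subring_polys_over[OF F]
  show "F \<subseteq> adjoin F s"
    using const_polys_over[OF F] is_subring_1[OF P] by (auto intro!: adjoinI[of "[:_:]" F 1])
  show "s \<in> adjoin F s"
    using is_subring_1[OF P] is_subring_0[OF F] is_subring_1[OF F] is_subring_0[OF P]
    by (intro adjoinI[of "[:0,1:]" F 1]) (auto intro!: pCons_polys_over)
qed

text \<open>Over the transcendental element \<open>s\<close>, evaluation at a natural number avoiding the finitely
  many poles in question replaces \<open>s\<close>.\<close>

lemma locally_rational_adjoin_transcendental:
  fixes F :: "'a::field_char_0 set"
  assumes F: "is_subfield F" and rat: "locally_rational F"
    and trans: "\<And>p. p \<in> polys_over F \<Longrightarrow> poly p s = 0 \<Longrightarrow> p = 0"
  shows "locally_rational (adjoin F s)"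
proof (rule locally_rational_transfer[OF rat])
  fix X assume X: "finite X" "X \<subseteq> adjoin F s"
  note FR = is_subfield_subring[OF F]
  note P = is_subring_polys_over[OF FR]
  have "\<forall>x\<in>X. \<exists>p q. p \<in> polys_over F \<and> q \<in> polys_over F \<and> poly q s \<noteq> 0 \<and> x = poly p s / poly q s"
    using X(2) unfolding adjoin_def by blast
  then obtain num den where nd: "\<And>x. x \<in> X \<Longrightarrow> num x \<in> polys_over F \<and> den x \<in> polys_over F \<and>
      poly (den x) s \<noteq> 0 \<and> x = poly (num x) s / poly (den x) s" by metis
  \<comment> \<open>The product collects all poles of the chosen fractions. It has finitely many
    roots, whereas in characteristic zero there are infinitely many natural numbers.\<close>
  have "(\<Prod>x\<in>X. den x) \<noteq> 0" using X(1) nd by (fastforce simp: prod_zero_iff)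
  then have "finite {z. poly (\<Prod>x\<in>X. den x) z = 0}" by (rule poly_roots_finite)
  then obtain z :: 'a where z: "z \<in> \<nat>" "poly (\<Prod>x\<in>X. den x) z \<noteq> 0"
    using Nats_infinite by (metis (mono_tags, lifting) finite_subset mem_Collect_eq subsetI)
  \<comment> \<open>A natural number lies in every subring, so specialisation keeps its values in
    \<open>F\<close>.\<close>
  have zF: "z \<in> F"
  proof -
    obtain n where n: "z = of_nat n" using z(1) by (auto elim: Nats_cases)
    have "of_nat n \<in> F"
      by (induction n) (auto intro: is_subring_0[OF FR] is_subring_add[OF FR] is_subring_1[OF FR])
    with n show ?thesis by simp
  qed
  \<comment> \<open>The denominator is tested at \<open>z\<close>, which makes \<open>S\<close> the
    local ring of F[s] at the point \<open>z\<close>. Such a \<open>q\<close> is a nonzero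
    polynomial, so it cannot vanish at the transcendental \<open>s\<close> either; this is
    \<open>nz\<close>.\<close>
  define frac where "frac x p q \<longleftrightarrow> p \<in> polys_over F \<and> q \<in> polys_over F \<and> poly q z \<noteq> 0 \<and>
      x = poly p s / poly q s" for x p q
  define S where "S = {x. \<exists>p q. frac x p q}"
  define ev where "ev x = (SOME v. \<exists>p q. frac x p q \<and> v = poly p z / poly q z)" for x
  have nz: "poly q s \<noteq> 0" if "frac x p q" for x p q
    using that trans[of q] by (auto simp: frac_def)
  \<comment> \<open>Well-definedness of \<open>ev\<close>: after cross-multiplication, equality at
    \<open>s\<close> becomes an identity of polynomials by transcendence, and this can be evaluated
    at \<open>z\<close>.\<close>
  have uniq: "poly p z / poly q z = poly p' z / poly q' z" if f: "frac x p q" "frac x p' q'" for x p q p' q'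
  proof -
    have "poly p s / poly q s = poly p' s / poly q' s" using f by (simp add: frac_def)
    then have "poly (p * q' - p' * q) s = 0"
      using nz[OF f(1)] nz[OF f(2)] by (simp add: frac_eq_eq)
    then have "p * q' - p' * q = 0"
      using f by (intro trans) (auto simp: frac_def intro!: is_subring_diff[OF P] is_subring_mult[OF P])
    then have "poly (p * q') z = poly (p' * q) z" by simp
    then show ?thesis using f by (auto simp: frac_def field_simps)
  qed
  have ev: "ev x = poly p z / poly q z" if f: "frac x p q" for x p q
    unfolding ev_def by (rule some_equality) (use f uniq in blast)+
  have frac1: "frac 1 1 1" by (auto simp: frac_def is_subring_1[OF P])
  have frac_diff: "frac (x - y) (p * q' - p' * q) (q * q')"
    and frac_add: "frac (x + y) (p * q' + p' * q) (q * q')"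
    and frac_mult: "frac (x * y) (p * p') (q * q')"
    if f: "frac x p q" "frac y p' q'" for x y p q p' q'
    using f nz[OF f(1)] nz[OF f(2)] unfolding frac_def
    by (auto intro!: is_subring_diff[OF P] is_subring_mult[OF P] is_subring_add[OF P]
        simp: diff_frac_eq add_frac_eq)
  have "is_subring S"
    unfolding is_subring_def S_def using frac1 frac_diff frac_mult by blast
  moreover have "ev 1 = 1" using ev[OF frac1] by simp
  moreover have "ev (x + y) = ev x + ev y" "ev (x * y) = ev x * ev y" if xy: "x \<in> S" "y \<in> S" for x y
  proof -
    obtain p q p' q' where f: "frac x p q" "frac y p' q'" using xy by (auto simp: S_def)
    show "ev (x + y) = ev x + ev y"
      unfolding ev[OF f(1)] ev[OF f(2)] ev[OF frac_add[OF f]] using f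
      by (auto simp: frac_def field_simps)
    show "ev (x * y) = ev x * ev y"
      unfolding ev[OF f(1)] ev[OF f(2)] ev[OF frac_mult[OF f]] by simp
  qed
  ultimately have "mat_rep S 1 (\<lambda>x. mat 1 1 (\<lambda>_. ev x))" by (rule mat_rep_scalar)
  moreover have "ev x \<in> F" if x: "x \<in> S" for x
  proof -
    obtain p q where f: "frac x p q" using x by (auto simp: S_def)
    show ?thesis unfolding ev[OF f]
      using f zF by (auto simp: frac_def intro!: is_subfield_divide[OF F] poly_in_subring[OF FR])
  qed
  moreover have "X \<subseteq> S"
  proof
    fix x assume x: "x \<in> X"
    have "poly (den x) z \<noteq> 0" using z(2) X(1) x by (auto simp: poly_prod)
    then have "frac x (num x) (den x)" using nd[OF x] by (auto simp: frac_def)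
    then show "x \<in> S" by (auto simp: S_def)
  qed
  ultimately show "\<exists>S e (\<rho> :: 'a \<Rightarrow> 'a mat). X \<subseteq> S \<and> mat_rep S e \<rho> \<and> (\<forall>x\<in>S. \<rho> x \<in> mat_over F e e)"
    by (intro exI[of _ S] exI[of _ 1] exI[of _ "\<lambda>x. mat 1 1 (\<lambda>_. ev x)"]) (auto intro!: mat_overI)
qed

text \<open>The point is that quotient and remainder keep their coefficients in \<open>F\<close>.
  Bounding the remainder by vanishing coefficients instead of by its degree also covers the zero
  remainder and constant \<open>q\<close>.\<close>

lemma division_polys_over:
  assumes F: "is_subfield F" and q: "q \<in> polys_over F" "q \<noteq> 0" and p: "p \<in> polys_over F"
  shows "\<exists>t\<in>polys_over F. \<exists>r\<in>polys_over F. p = q * t + r \<and> (\<forall>i\<ge>degree q. coeff r i = 0)"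
  using p
proof (induction p)
  case 0
  note P = is_subring_polys_over[OF is_subfield_subring[OF F]]
  show ?case by (intro bexI[of _ 0]) (auto simp: is_subring_0[OF P])
next
  case (pCons a p)
  note FR = is_subfield_subring[OF F]
  note P = is_subring_polys_over[OF FR]
  note ap = polys_over_pConsD[OF pCons.prems]
  obtain t r where t: "t \<in> polys_over F" and r: "r \<in> polys_over F"
    and eq: "p = q * t + r" and small: "\<forall>i\<ge>degree q. coeff r i = 0"
    using pCons.IH ap by blast
  \<comment> \<open>Horner step: with X the indeterminate, p = q t + r gives a + X p = q (X t) + (a
    + X r). The new remainder \<open>r1\<close> has degree at most that of \<open>q\<close>, and
    subtracting \<open>c\<close> times \<open>q\<close> removes its coefficient there.\<close>
  define r1 where "r1 = pCons a r"
  define c where "c = coeff r1 (degree q) / lead_coeff q"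
  have r1: "r1 \<in> polys_over F" using ap r by (simp add: r1_def pCons_polys_over)
  have c: "c \<in> F" unfolding c_def using q r1 by (intro is_subfield_divide[OF F]) (auto dest: polys_overD)
  have "pCons a p = q * (pCons 0 t + [:c:]) + (r1 - Polynomial.smult c q)"
    by (simp add: eq r1_def algebra_simps)
  moreover have "pCons 0 t + [:c:] \<in> polys_over F"
    using t c by (intro is_subring_add[OF P] pCons_polys_over const_polys_over FR is_subring_0[OF FR])
  moreover have "r1 - Polynomial.smult c q \<in> polys_over F"
    using r1 c q by (intro is_subring_diff[OF P] smult_polys_over FR)
  moreover have "coeff (r1 - Polynomial.smult c q) i = 0" if i: "i \<ge> degree q" for i
  proof (cases "i = degree q")
    case False
    then obtain j where j: "i = Suc j" "j \<ge> degree q" using i by (cases i) auto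
    then show ?thesis using small False i by (simp add: r1_def coeff_eq_0)
  qed (use q in \<open>simp add: c_def\<close>)
  ultimately show ?case by blast
qed

text \<open>The length \<open>e\<close> does not depend on \<open>r\<close>, so the coefficients can
  serve as a row of an e x e matrix.\<close>

lemma poly_eq_sum_lessThan:
  fixes r :: "'a::comm_semiring_1 poly"
  assumes "\<forall>i\<ge>e. coeff r i = 0"
  shows "poly r s = (\<Sum>j<e. coeff r j * s ^ j)"
proof -
  have "poly r s = (\<Sum>j\<in>{..degree r}. coeff r j * s ^ j)" by (simp add: poly_altdef)
  also have "\<dots> = (\<Sum>j\<in>{..degree r} \<inter> {..<e}. coeff r j * s ^ j)"
    using assms by (intro sum.mono_neutral_right) (auto, metis mult_zero_left not_le)
  also have "\<dots> = (\<Sum>j<e. coeff r j * s ^ j)"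
    by (intro sum.mono_neutral_left) (auto intro!: le_degree)
  finally show ?thesis .
qed

text \<open>An algebraic element acts \<open>F\<close>-linearly on \<open>F[s]\<close>; in the basis of powers of \<open>s\<close> this is the
  regular representation.\<close>

lemma locally_rational_adjoin_algebraic:
  fixes F :: "'a::field set"
  assumes F: "is_subfield F" and rat: "locally_rational F"
    and alg: "p \<in> polys_over F" "poly p s = 0" "p \<noteq> 0"
  shows "locally_rational (adjoin F s)"
proof -
  note FR = is_subfield_subring[OF F]
  note P = is_subring_polys_over[OF FR]
  \<comment> \<open>A minimal polynomial of \<open>s\<close> up to a scalar factor; \<open>e\<close>
    is the degree of \<open>s\<close> over \<open>F\<close>.\<close>
  define \<mu> where "\<mu> = arg_min degree (\<lambda>p. p \<in> polys_over F \<and> poly p s = 0 \<and> p \<noteq> 0)"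
  define e where "e = degree \<mu>"
  have \<mu>: "\<mu> \<in> polys_over F" "poly \<mu> s = 0" "\<mu> \<noteq> 0"
    and min: "\<And>q. q \<in> polys_over F \<Longrightarrow> poly q s = 0 \<Longrightarrow> q \<noteq> 0 \<Longrightarrow> e \<le> degree q"
    using arg_min_natI[of "\<lambda>p. p \<in> polys_over F \<and> poly p s = 0 \<and> p \<noteq> 0" p degree] alg
      arg_min_nat_le[of "\<lambda>p. p \<in> polys_over F \<and> poly p s = 0 \<and> p \<noteq> 0" _ degree]
    by (auto simp: \<mu>_def e_def)
  have e: "0 < e"
  proof (rule ccontr)
    assume "\<not> 0 < e"
    then obtain c where "\<mu> = [:c:]" by (auto simp: e_def elim: degree_eq_zeroE)
    with \<mu> show False by simp
  qed
  have small_zero: "r = 0" if r: "r \<in> polys_over F" "\<forall>i\<ge>e. coeff r i = 0" "poly r s = 0" for r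
    using min[of r] r by (metis leading_coeff_0_iff)
  have reduce: "\<exists>r\<in>polys_over F. (\<forall>i\<ge>e. coeff r i = 0) \<and> poly r s = poly p s"
    if p: "p \<in> polys_over F" for p
  proof -
    obtain t r where "t \<in> polys_over F" "r \<in> polys_over F" "p = \<mu> * t + r" "\<forall>i\<ge>e. coeff r i = 0"
      using division_polys_over[OF F \<mu>(1,3) p] by (auto simp: e_def)
    then show ?thesis using \<mu>(2) by auto
  qed
  \<comment> \<open>This makes F[s] a field, by descent on the degree: from \<mu> = q t + r one gets
    q(s) t(s) = -r(s), so if u(s) inverts r(s), then -t u takes at \<open>s\<close> the value
    inverse to q(s).\<close>
  have inv: "\<exists>t\<in>polys_over F. poly q s * poly t s = 1"
    if q: "q \<in> polys_over F" "\<forall>i\<ge>e. coeff q i = 0" "poly q s \<noteq> 0" for q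
    using q
  proof (induction "degree q" arbitrary: q rule: less_induct)
    case less
    have q0: "q \<noteq> 0" using less.prems by auto
    have dq: "degree q < e" using less.prems(2) q0 by (metis leading_coeff_0_iff not_le)
    obtain t r where t: "t \<in> polys_over F" and r: "r \<in> polys_over F"
      and eq: "\<mu> = q * t + r" and small: "\<forall>i\<ge>degree q. coeff r i = 0"
      using division_polys_over[OF F less.prems(1) q0 \<mu>(1)] by blast
    have small': "\<forall>i\<ge>e. coeff r i = 0" using small dq by auto
    have val: "poly q s * poly t s + poly r s = 0" using \<mu>(2) by (simp add: eq)
    show ?case
    proof (cases "degree q = 0")
      case True
      then obtain c where c: "q = [:c:]" by (auto elim: degree_eq_zeroE)
      have "c \<in> F" using polys_overD[OF less.prems(1), of 0] c by simp
      then show ?thesis using q0 c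
        by (intro bexI[of _ "[:inverse c:]"]) (auto intro!: const_polys_over FR is_subfield_inverse[OF F])
    next
      case False
      \<comment> \<open>If r(s) = 0, minimality gives r = 0 and \<mu> = q t with t(s) = 0. As
        \<open>q\<close> is not constant, \<open>t\<close> has smaller degree than \<mu>, a
        contradiction.\<close>
      have rs: "poly r s \<noteq> 0"
      proof
        assume r0: "poly r s = 0"
        then have "poly t s = 0" using val less.prems(3) by simp
        moreover have "\<mu> = q * t" using small_zero[OF r small' r0] eq by simp
        then have "t \<noteq> 0" "e = degree q + degree t" using \<mu>(3) q0 by (auto simp: e_def degree_mult_eq)
        ultimately show False using min[OF t] False by simp
      qed
      then have "r \<noteq> 0" by auto
      then have "degree r < degree q" using small by (metis leading_coeff_0_iff not_le)
      then obtain u where u: "u \<in> polys_over F" "poly r s * poly u s = 1"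
        using less.hyps r small' rs by blast
      have "poly q s * poly (- (t * u)) s = - (poly q s * poly t s) * poly u s" by simp
      also have "- (poly q s * poly t s) = poly r s" using val by (simp add: add_eq_0_iff)
      finally have "poly q s * poly (- (t * u)) s = 1" using u by simp
      moreover have "- (t * u) \<in> polys_over F"
        using t u by (intro is_subring_uminus[OF P] is_subring_mult[OF P])
      ultimately show ?thesis by blast
    qed
  qed
  have adj: "\<exists>r\<in>polys_over F. x = poly r s" if x: "x \<in> adjoin F s" for x
  proof -
    obtain p q where pq: "p \<in> polys_over F" "q \<in> polys_over F" "poly q s \<noteq> 0" "x = poly p s / poly q s"
      using x by (auto simp: adjoin_def)
    obtain q' where q': "q' \<in> polys_over F" "\<forall>i\<ge>e. coeff q' i = 0" "poly q' s = poly q s"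
      using reduce[OF pq(2)] by blast
    obtain t where t: "t \<in> polys_over F" "poly q s * poly t s = 1"
      using inv[OF q'(1,2)] q'(3) pq(3) by auto
    have "poly t s = 1 / poly q s" using pq(3) t(2) by (simp add: eq_divide_eq mult.commute)
    then have "x = poly (p * t) s" using pq(4) by simp
    then show ?thesis using is_subring_mult[OF P pq(1) t(1)] by blast
  qed
  \<comment> \<open>Linear independence of 1, s, ..., s^(e-1) over \<open>F\<close>: a relation
    would be a polynomial of degree below \<open>e\<close> vanishing at \<open>s\<close>.\<close>
  have indep: "\<forall>j<e. c j = d j" if cd: "\<And>j. j < e \<Longrightarrow> c j \<in> F" "\<And>j. j < e \<Longrightarrow> d j \<in> F"
    "(\<Sum>j<e. c j * s ^ j) = (\<Sum>j<e. d j * s ^ j)" for c d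
  proof -
    define r where "r = (\<Sum>j<e. monom (c j - d j) j)"
    have cr: "coeff r i = (if i < e then c i - d i else 0)" for i
      by (simp add: r_def coeff_sum)
    have "r \<in> polys_over F"
      using cd by (auto simp: polys_over_def cr intro!: is_subring_diff[OF FR] is_subring_0[OF FR])
    moreover have "poly r s = 0" using cd(3) by (simp add: r_def poly_sum poly_monom algebra_simps sum_subtractf)
    ultimately have "r = 0" using small_zero[of r] cr by simp
    then show ?thesis using cr by (metis coeff_0 right_minus_eq)
  qed
  \<comment> \<open>Row \<open>i\<close> of \<open>M\<close> holds the coordinates of x s^i. With
    this row convention products come out reversed, as \<open>N * M\<close> for
    \<open>x * y\<close>; commutativity of the field restores the order when \<open>\<rho>\<close>
    is shown multiplicative.\<close>
  define reg where "reg x M \<longleftrightarrow> M \<in> mat_over F e e \<and> (\<forall>i<e. x * s ^ i = (\<Sum>j<e. M $$ (i,j) * s ^ j))" for x M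
  have uniq: "M = N" if M: "reg x M" and N: "reg x N" for x M N
  proof (rule eq_matI)
    have c: "M \<in> carrier_mat e e" "N \<in> carrier_mat e e" using M N by (auto simp: reg_def dest: mat_overD(1))
    then show "dim_row M = dim_row N" "dim_col M = dim_col N" by auto
    fix i j assume "i < dim_row N" "j < dim_col N"
    then have ij: "i < e" "j < e" using c by auto
    have mem: "M $$ (i,k) \<in> F" "N $$ (i,k) \<in> F" if "k < e" for k
      using M N ij(1) that unfolding reg_def by (blast intro: mat_overD(2))+
    have "x * s ^ i = (\<Sum>j<e. M $$ (i,j) * s ^ j)" "x * s ^ i = (\<Sum>j<e. N $$ (i,j) * s ^ j)"
      using M N ij(1) unfolding reg_def by blast+
    then have "\<forall>k<e. M $$ (i,k) = N $$ (i,k)" using mem by (intro indep) auto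
    then show "M $$ (i,j) = N $$ (i,j)" using ij by blast
  qed
  have reg_one: "reg 1 (1\<^sub>m e)"
    by (auto simp: reg_def one_mat_over FR if_distrib[of "\<lambda>x. x * _"] cong: if_cong)
  have reg_add: "reg (x + y) (M + N)" and reg_diff: "reg (x - y) (M - N)" and reg_mult: "reg (x * y) (N * M)"
    if M: "reg x M" and N: "reg y N" for x y M N
  proof -
    have Mc: "M \<in> mat_over F e e" and Nc: "N \<in> mat_over F e e" using M N by (auto simp: reg_def)
    note c = mat_overD(1)[OF Mc] mat_overD(1)[OF Nc]
    note eqs = M[unfolded reg_def, THEN conjunct2, rule_format] N[unfolded reg_def, THEN conjunct2, rule_format]
    show "reg (x + y) (M + N)" unfolding reg_def
      using c mat_overD(2)[OF Mc] mat_overD(2)[OF Nc]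
      by (auto intro!: mat_overI is_subring_add[OF FR] simp: distrib_right eqs sum.distrib)
    show "reg (x - y) (M - N)" unfolding reg_def
      using c mat_overD(2)[OF Mc] mat_overD(2)[OF Nc]
      by (auto intro!: mat_overI is_subring_diff[OF FR] simp: left_diff_distrib eqs sum_subtractf)
    have "x * y * s ^ i = (\<Sum>k<e. (N * M) $$ (i,k) * s ^ k)" if i: "i < e" for i
    proof -
      have "x * y * s ^ i = (\<Sum>j<e. N $$ (i,j) * (x * s ^ j))"
        using eqs(2)[OF i] by (simp add: mult.assoc sum_distrib_left mult.left_commute)
      also have "\<dots> = (\<Sum>j<e. \<Sum>k<e. N $$ (i,j) * M $$ (j,k) * s ^ k)"
        by (intro sum.cong) (auto simp: eqs(1) sum_distrib_left mult.assoc)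
      also have "\<dots> = (\<Sum>k<e. \<Sum>j<e. N $$ (i,j) * M $$ (j,k) * s ^ k)" by (rule sum.swap)
      also have "\<dots> = (\<Sum>k<e. (N * M) $$ (i,k) * s ^ k)"
        using c i by (auto simp: scalar_prod_def sum_distrib_right atLeast0LessThan intro!: sum.cong)
      finally show ?thesis .
    qed
    then show "reg (x * y) (N * M)" using mult_mat_over[OF FR Nc Mc] by (simp add: reg_def)
  qed
  define S where "S = {x. \<exists>M. reg x M}"
  define \<rho> where "\<rho> x = (THE M. reg x M)" for x
  have \<rho>: "\<rho> x = M" if "reg x M" for x M
    unfolding \<rho>_def by (rule the_equality[where P = "reg x"]) (use that uniq in auto)
  have "is_subring S" unfolding is_subring_def S_def using reg_one reg_diff reg_mult by blast
  moreover have "\<rho> (x + y) = \<rho> x + \<rho> y \<and> \<rho> (x * y) = \<rho> x * \<rho> y \<and> \<rho> x \<in> carrier_mat e e"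
    if "x \<in> S" "y \<in> S" for x y
  proof -
    obtain M N where MN: "reg x M" "reg y N" using \<open>x \<in> S\<close> \<open>y \<in> S\<close> by (auto simp: S_def)
    have "reg (x * y) (M * N)" using reg_mult[OF MN(2,1)] by (simp add: mult.commute)
    then show ?thesis
      unfolding \<rho>[OF MN(1)] \<rho>[OF MN(2)] \<rho>[OF reg_add[OF MN]]
      using MN by (auto simp: \<rho> reg_def dest: mat_overD(1))
  qed
  ultimately have rep: "mat_rep S e \<rho>"
    using e \<rho>[OF reg_one] by (auto simp: mat_rep_def)
  have sub: "adjoin F s \<subseteq> S"
  proof
    fix x assume x: "x \<in> adjoin F s"
    have sp: "s ^ i \<in> adjoin F s" for i
      by (rule is_subring_power[OF is_subfield_subring[OF is_subfield_adjoin[OF FR]] subset_adjoin(2)[OF FR]])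
    \<comment> \<open>Each x s^i lies in F(s) = F[s]; reducing it modulo \<mu> gives the rows of the
      matrix of \<open>x\<close>.\<close>
    have "\<forall>i. \<exists>r\<in>polys_over F. (\<forall>j\<ge>e. coeff r j = 0) \<and> poly r s = x * s ^ i"
      using adj reduce is_subring_mult[OF is_subfield_subring[OF is_subfield_adjoin[OF FR]] x sp] by metis
    then obtain r where r: "\<And>i. r i \<in> polys_over F" "\<And>i. \<forall>j\<ge>e. coeff (r i) j = 0"
      "\<And>i. poly (r i) s = x * s ^ i" by metis
    have "reg x (mat e e (\<lambda>(i,j). coeff (r i) j))"
      unfolding reg_def
      by (auto intro!: mat_overI simp: r(3)[symmetric] poly_eq_sum_lessThan[OF r(2)] polys_overD[OF r(1)])
    then show "x \<in> S" by (auto simp: S_def)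
  qed
  have over: "\<forall>x\<in>S. \<rho> x \<in> mat_over F e e" using \<rho> by (auto simp: S_def reg_def)
  show ?thesis
  proof (rule locally_rational_transfer[OF rat])
    fix X assume "finite X" "X \<subseteq> adjoin F s"
    then show "\<exists>S e (\<rho> :: 'a \<Rightarrow> 'a mat). X \<subseteq> S \<and> mat_rep S e \<rho> \<and> (\<forall>x\<in>S. \<rho> x \<in> mat_over F e e)"
      using sub rep over by (intro exI[of _ S] exI[of _ e] exI[of _ \<rho>]) auto
  qed
qed

lemma finite_subset_mat_rep:
  fixes X :: "'a::field_char_0 set"
  assumes "finite X"
  shows "\<exists>R d (\<phi> :: 'a \<Rightarrow> rat mat). X \<subseteq> R \<and> mat_rep R d \<phi>"
proof -
  have "\<exists>F. is_subfield F \<and> locally_rational F \<and> X \<subseteq> F"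
    using assms
  proof (induction X rule: finite_induct)
    case empty
    have "is_subfield (\<rat> :: 'a set)" by (auto simp: is_subfield_def is_subring_Rats)
    then show ?case using locally_rational_Rats by blast
  next
    case (insert s X)
    then obtain F where F: "is_subfield F" "locally_rational F" "X \<subseteq> F" by blast
    \<comment> \<open>The hypotheses of the two lemmas are complementary: either some nonzero
      polynomial over \<open>F\<close> vanishes at \<open>s\<close> or none does.\<close>
    have "locally_rational (adjoin F s)"
      using locally_rational_adjoin_algebraic[OF F(1,2)] locally_rational_adjoin_transcendental[OF F(1,2)]
      by blast
    then show ?case
      using is_subfield_adjoin subset_adjoin[of F s] is_subfield_subring[OF F(1)] F(3)
      by (intro exI[of _ "adjoin F s"]) auto
  qed
  then show ?thesis using assms unfolding locally_rational_def by blast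
qed

section \<open>Rank under entrywise representations\<close>

context vec_space
begin

text \<open>Each column of A B is A applied to a column of B, hence lies in the column space of
  A.\<close>

lemma rank_mult_le_left:
  assumes A: "A \<in> carrier_mat n m" and B: "B \<in> carrier_mat m l"
  shows "rank (A * B) \<le> rank A"
proof -
  let ?W = "span (set (cols A))" and ?X = "span (set (cols (A * B)))"
  have AB: "A * B \<in> carrier_mat n l" using A B by auto
  have colsA: "set (cols A) \<subseteq> carrier_vec n" and colsAB: "set (cols (A * B)) \<subseteq> carrier_vec n"
    using cols_dim[of A] cols_dim[of "A * B"] A AB by auto
  have "set (cols (A * B)) \<subseteq> ?W"
  proof
    fix v assume "v \<in> set (cols (A * B))"
    then obtain j where j: "j < l" "v = col (A * B) j"
      using AB by (auto simp: cols_def)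
    then have "v = A *\<^sub>v col B j" using col_mult2[OF A B] by simp
    moreover have "col B j \<in> carrier_vec m" using B j by auto
    ultimately have "v \<in> col_space A" unfolding col_space_eq[OF A] using A B by auto
    then show "v \<in> ?W" by (simp add: col_space_def)
  qed
  then have XW: "?X \<subseteq> ?W" by (simp add: span_is_subset colsA span_is_submodule)
  have W: "subspace class_ring ?W V" and X: "subspace class_ring ?X V"
    using span_is_subspace colsA colsAB by auto
  have "vectorspace.fin_dim class_ring (vs ?W)" "vectorspace.fin_dim class_ring (vs ?X)"
    using fin_dim_span_cols A AB by auto
  then show ?thesis
    unfolding rank_def
    using vectorspace.subspace_dim[OF subspace_is_vs[OF W] nested_subspaces[OF W X XW]] by simp
qed

lemma rank_factor_le:
  assumes "L \<in> carrier_mat n r" and "U \<in> carrier_mat r m"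
  shows "rank (L * U) \<le> r"
  using rank_mult_le_left[OF assms] rank_le_nc[OF assms(1)] by linarith

text \<open>\<open>P\<close> is a left inverse of \<open>A * Q\<close>, so the \<open>r\<close>
  columns of \<open>A * Q\<close> are independent, and \<open>A * Q\<close> has rank at most that of
  \<open>A\<close>.\<close>

lemma le_rank_if_compresses_to_one:
  assumes A: "A \<in> carrier_mat n m" and P: "P \<in> carrier_mat r n" and Q: "Q \<in> carrier_mat m r"
    and PAQ: "P * A * Q = 1\<^sub>m r"
  shows "r \<le> rank A"
proof -
  have B: "A * Q \<in> carrier_mat n r" using A Q by auto
  have PB: "P * (A * Q) = 1\<^sub>m r" using PAQ assoc_mult_mat[OF P A Q] by simp
  \<comment> \<open>Independence is a property of the set of columns, so coinciding columns have to
    be excluded separately.\<close>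
  have distinct: "distinct (cols (A * Q))"
  proof -
    have "i = j" if ij: "i < r" "j < r" "col (A * Q) i = col (A * Q) j" for i j
    proof -
      have "col (1\<^sub>m r) i = col (1\<^sub>m r :: 'a mat) j"
        using col_mult2[OF P B] ij by (metis PB)
      then have "unit_vec r i = (unit_vec r j :: 'a vec)" using ij by simp
      then show ?thesis using ij by (metis index_unit_vec(1,2) zero_neq_one)
    qed
    then show ?thesis using B by (auto simp: distinct_conv_nth)
  qed
  have "lin_indpt (set (cols (A * Q)))"
  proof
    assume "lin_dep (set (cols (A * Q)))"
    then obtain v where v: "v \<in> carrier_vec r" "v \<noteq> 0\<^sub>v r" "(A * Q) *\<^sub>v v = 0\<^sub>v n"
      using lin_depE[OF B _ distinct] by blast
    have "v = (P * (A * Q)) *\<^sub>v v" using v PB by simp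
    also have "\<dots> = P *\<^sub>v ((A * Q) *\<^sub>v v)" by (rule assoc_mult_mat_vec[OF P B v(1)])
    also have "\<dots> = 0\<^sub>v r" using v P by (auto intro!: eq_vecI simp: scalar_prod_def)
    finally show False using v by simp
  qed
  then have "rank (A * Q) = r" using lin_indpt_full_rank[OF B distinct] by simp
  then show ?thesis using rank_mult_le_left[OF A Q] by simp
qed

lemma rank_eqI:
  assumes "A \<in> carrier_mat n m"
    and "L \<in> carrier_mat n r" "U \<in> carrier_mat r m" "A = L * U"
    and "P \<in> carrier_mat r n" "Q \<in> carrier_mat m r" "P * A * Q = 1\<^sub>m r"
  shows "rank A = r"
  using le_rank_if_compresses_to_one[OF assms(1,5,6,7)] rank_factor_le[OF assms(2,3)] assms(4) by simp

text \<open>All four witnesses are read off Gauss-Jordan elimination C = P0 A with Q0 inverse to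
  P0.\<close>

lemma rank_factorization:
  assumes A: "A \<in> carrier_mat n m"
  obtains L U P Q where "L \<in> carrier_mat n (rank A)" "U \<in> carrier_mat (rank A) m" "A = L * U"
    "P \<in> carrier_mat (rank A) n" "Q \<in> carrier_mat m (rank A)" "P * A * Q = 1\<^sub>m (rank A)"
proof -
  define C where "C = gauss_jordan_single A"
  note gj = gauss_jordan_single[OF A C_def[symmetric]]
  have C: "C \<in> carrier_mat n m" by (rule gj(2))
  obtain f where f: "pivot_fun C f m" using gj(3) C by (auto simp: row_echelon_form_def)
  obtain P0 Q0 where P0: "C = P0 * A" "P0 \<in> carrier_mat n n" and Q0: "Q0 \<in> carrier_mat n n" "Q0 * P0 = 1\<^sub>m n"
    using gj(4) by blast
  have A_eq: "A = Q0 * C"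
    unfolding P0(1) using assoc_mult_mat[OF Q0(1) P0(2) A] Q0(2) A by simp
  note pivot = pivot_funD[OF carrier_matD(1)[OF C] f]
  \<comment> \<open>The number of nonzero rows of \<open>C\<close>. A zero row has pivot value
    \<open>m\<close>; pivots increase strictly until they reach \<open>m\<close>, so zero rows come
    last. The bound \<open>n\<close> covers the case without zero rows.\<close>
  define r where "r = (LEAST i. i \<ge> n \<or> f i = m)"
  have "r \<ge> n \<or> f r = m" unfolding r_def by (rule LeastI[of _ n]) simp
  moreover have r_le: "r \<le> n" unfolding r_def by (rule Least_le) simp
  ultimately have r: "r = n \<or> f r = m" by auto
  have less: "i < n" "f i < m" if "i < r" for i
    using not_less_Least[of i "\<lambda>i. i \<ge> n \<or> f i = m"] that pivot(1)[of i] unfolding r_def by auto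
  have ge: "f i = m" if "r \<le> i" "i < n" for i
    using that
  proof (induction i rule: dec_induct)
    case base
    then show ?case using r by simp
  next
    case (step i)
    then show ?case using pivot(1)[of "Suc i"] pivot(3)[of i] by auto
  qed
  have zero: "C $$ (i,j) = 0" if "r \<le> i" "i < n" "j < m" for i j
    using pivot(2)[of i j] ge[of i] that by simp
  \<comment> \<open>\<open>L\<close> keeps the columns of \<open>Q0\<close> that meet nonzero rows
    of \<open>C\<close>, \<open>U\<close> those rows, and \<open>P\<close> the matching rows of
    \<open>P0\<close>. \<open>Q\<close> selects the pivot columns, on which \<open>U\<close> is the
    identity.\<close>
  define L where "L = mat n r (\<lambda>(i,j). Q0 $$ (i,j))"
  define U where "U = mat r m (\<lambda>(i,j). C $$ (i,j))"
  define P where "P = mat r n (\<lambda>(i,j). P0 $$ (i,j))"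
  define Q where "Q = mat m r (\<lambda>(i,j). if i = f j then 1 else 0 :: 'a)"
  have carriers: "L \<in> carrier_mat n r" "U \<in> carrier_mat r m" "P \<in> carrier_mat r n" "Q \<in> carrier_mat m r"
    by (simp_all add: L_def U_def P_def Q_def)
  have LU: "A = L * U"
  proof (rule eq_matI)
    fix i j assume "i < dim_row (L * U)" "j < dim_col (L * U)"
    then have ij: "i < n" "j < m" using carriers by auto
    have "A $$ (i,j) = (\<Sum>k\<in>{0..<n}. Q0 $$ (i,k) * C $$ (k,j))"
      using ij Q0(1) C by (simp add: A_eq scalar_prod_def)
    also have "\<dots> = (\<Sum>k\<in>{0..<r}. Q0 $$ (i,k) * C $$ (k,j))"
      using r_le zero ij by (intro sum.mono_neutral_right) auto
    also have "\<dots> = (L * U) $$ (i,j)" using ij by (simp add: L_def U_def scalar_prod_def)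
    finally show "A $$ (i,j) = (L * U) $$ (i,j)" .
  qed (use A carriers in auto)
  have PA: "P * A = U"
  proof (rule eq_matI)
    fix i j assume "i < dim_row U" "j < dim_col U"
    then have ij: "i < r" "j < m" using carriers by auto
    have "U $$ (i,j) = (P0 * A) $$ (i,j)" using ij P0(1) by (simp add: U_def)
    then show "(P * A) $$ (i,j) = U $$ (i,j)"
      using ij less P0(2) A by (simp add: P_def scalar_prod_def)
  qed (use A carriers in auto)
  have "U * Q = 1\<^sub>m r"
  proof (rule eq_matI)
    fix i j assume "i < dim_row (1\<^sub>m r :: 'a mat)" "j < dim_col (1\<^sub>m r :: 'a mat)"
    then have ij: "i < r" "j < r" by auto
    have "(U * Q) $$ (i,j) = (\<Sum>k\<in>{0..<m}. C $$ (i,k) * (if k = f j then 1 else 0))"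
      using ij by (simp add: U_def Q_def scalar_prod_def)
    also have "\<dots> = (\<Sum>k\<in>{0..<m}. if k = f j then C $$ (i,k) else 0)"
      by (intro sum.cong) auto
    also have "\<dots> = C $$ (i, f j)" using less[OF ij(2)] by simp
    also have "\<dots> = 1\<^sub>m r $$ (i,j)" using ij less pivot(4,5) by auto
    finally show "(U * Q) $$ (i,j) = 1\<^sub>m r $$ (i,j)" .
  qed (use carriers in auto)
  then have PAQ: "P * A * Q = 1\<^sub>m r" using PA by simp
  \<comment> \<open>Only here is \<open>r\<close> identified with the rank, by the certificate just
    built.\<close>
  have "rank A = r" by (rule rank_eqI[OF A carriers(1,2) LU carriers(3,4) PAQ])
  then show ?thesis using that[of L U P Q] carriers LU PAQ by simp
qed

text \<open>Rank is defined through columns, so left multiplication is handled by a factorisation A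
  = L U of inner size rk A: B A = (B L) U has the same inner size.\<close>

lemma rank_mult_le_right:
  assumes A: "A \<in> carrier_mat n m" and B: "B \<in> carrier_mat n n"
  shows "rank (B * A) \<le> rank A"
proof -
  obtain L U P Q where LU: "L \<in> carrier_mat n (rank A)" "U \<in> carrier_mat (rank A) m" "A = L * U"
    and "P \<in> carrier_mat (rank A) n" "Q \<in> carrier_mat m (rank A)" "P * A * Q = 1\<^sub>m (rank A)"
    by (rule rank_factorization[OF A])
  have "B * A = (B * L) * U" by (subst LU(3)) (rule assoc_mult_mat[OF B LU(1,2), symmetric])
  moreover have "B * L \<in> carrier_mat n (rank A)" using B LU(1) by (rule mult_carrier_mat)
  ultimately show ?thesis using rank_factor_le[OF _ LU(2), of "B * L"] by simp
qed

end

section \<open>Rank of block matrices\<close>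

lemma rank_block_mat:
  fixes \<phi> :: "'a::field \<Rightarrow> 'b::field mat"
  assumes rep: "mat_rep R d \<phi>" and A: "A \<in> mat_over R n m"
    and L: "L \<in> mat_over R n r" and U: "U \<in> mat_over R r m" and LU: "A = L * U"
    and P: "P \<in> mat_over R r n" and Q: "Q \<in> mat_over R m r" and PAQ: "P * A * Q = 1\<^sub>m r"
  shows "vec_space.rank (n * d) (block_mat \<phi> d A) = r * d"
proof (rule vec_space.rank_eqI)
  note c = A[THEN mat_overD(1)] L[THEN mat_overD(1)] U[THEN mat_overD(1)] P[THEN mat_overD(1)]
    Q[THEN mat_overD(1)]
  show "block_mat \<phi> d A \<in> carrier_mat (n * d) (m * d)" "block_mat \<phi> d L \<in> carrier_mat (n * d) (r * d)"
    "block_mat \<phi> d U \<in> carrier_mat (r * d) (m * d)" "block_mat \<phi> d P \<in> carrier_mat (r * d) (n * d)"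
    "block_mat \<phi> d Q \<in> carrier_mat (m * d) (r * d)"
    using c by (simp_all add: block_mat_carrier)
  show "block_mat \<phi> d A = block_mat \<phi> d L * block_mat \<phi> d U"
    unfolding LU by (rule block_mat_mult[OF rep L U])
  note PA = mult_mat_over[OF mat_rep_subring[OF rep] P A]
  show "block_mat \<phi> d P * block_mat \<phi> d A * block_mat \<phi> d Q = 1\<^sub>m (r * d)"
    unfolding block_mat_mult[OF rep P A, symmetric] block_mat_mult[OF rep PA Q, symmetric] PAQ
    by (rule block_mat_one[OF rep])
qed

lemma finite_matrices_rational_model:
  fixes M :: "'a::field_char_0 mat set"
  assumes fin: "finite M" and M: "M \<subseteq> carrier_mat n n"
  shows "\<exists>R d (\<phi> :: 'a \<Rightarrow> rat mat). mat_rep R d \<phi> \<and> M \<subseteq> mat_over R n n \<and>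
    (\<forall>A\<in>M. vec_space.rank (n * d) (block_mat \<phi> d A) = vec_space.rank n A * d)"
proof -
  let ?r = "vec_space.rank n"
  have "\<forall>A\<in>M. \<exists>L U P Q. L \<in> carrier_mat n (?r A) \<and> U \<in> carrier_mat (?r A) n \<and> A = L * U \<and>
    P \<in> carrier_mat (?r A) n \<and> Q \<in> carrier_mat n (?r A) \<and> P * A * Q = 1\<^sub>m (?r A)"
  proof
    fix A assume "A \<in> M"
    then have "A \<in> carrier_mat n n" using M by auto
    then obtain L U P Q where "L \<in> carrier_mat n (?r A)" "U \<in> carrier_mat (?r A) n" "A = L * U"
      "P \<in> carrier_mat (?r A) n" "Q \<in> carrier_mat n (?r A)" "P * A * Q = 1\<^sub>m (?r A)"
      by (rule vec_space.rank_factorization)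
    then show "\<exists>L U P Q. L \<in> carrier_mat n (?r A) \<and> U \<in> carrier_mat (?r A) n \<and> A = L * U \<and>
      P \<in> carrier_mat (?r A) n \<and> Q \<in> carrier_mat n (?r A) \<and> P * A * Q = 1\<^sub>m (?r A)"
      by (intro exI conjI)
  qed
  then obtain L U P Q where f: "\<And>A. A \<in> M \<Longrightarrow> L A \<in> carrier_mat n (?r A) \<and> U A \<in> carrier_mat (?r A) n \<and> A = L A * U A \<and>
    P A \<in> carrier_mat (?r A) n \<and> Q A \<in> carrier_mat n (?r A) \<and> P A * A * Q A = 1\<^sub>m (?r A)"
    by metis
  \<comment> \<open>The rank witnesses are fixed before the ring. Their entries, such as inverses of
    pivots, need not lie in the ring generated by the entries of the matrices in
    \<open>M\<close>.\<close>
  define X where "X = (\<Union>A\<in>M. elements_mat A \<union> elements_mat (L A) \<union> elements_mat (U A)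
    \<union> elements_mat (P A) \<union> elements_mat (Q A))"
  have "finite X" using fin by (auto simp: X_def elements_mat_def)
  from finite_subset_mat_rep[OF this]
  obtain R d and \<phi> :: "'a \<Rightarrow> rat mat" where R: "X \<subseteq> R" "mat_rep R d \<phi>"
    by (elim exE conjE)
  have sub: "elements_mat A \<subseteq> R" "elements_mat (L A) \<subseteq> R" "elements_mat (U A) \<subseteq> R"
    "elements_mat (P A) \<subseteq> R" "elements_mat (Q A) \<subseteq> R" if "A \<in> M" for A
    using that R(1) unfolding X_def by (simp_all add: UN_subset_iff)
  have over: "A \<in> mat_over R n n" if "A \<in> M" for A
    using sub(1)[OF that] M that unfolding mat_over_def by auto
  have "?r A * d = vec_space.rank (n * d) (block_mat \<phi> d A)" if A: "A \<in> M" for A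
    using f[OF A] sub[OF A]
    by (intro rank_block_mat[OF R(2) over[OF A], of "L A" "?r A" "U A" "P A" "Q A", symmetric])
      (auto simp: mat_over_def)
  then show ?thesis using R(2) over by (intro exI[of _ R] exI[of _ d] exI[of _ \<phi>]) auto
qed

section \<open>Metric ultraproducts of general linear groups\<close>

lemma nrank_nonneg: "0 \<le> nrank n A"
  by (simp add: nrank_def)

lemma nrank_mono: "vec_space.rank n A \<le> vec_space.rank n B \<Longrightarrow> nrank n A \<le> nrank n B"
  by (simp add: nrank_def divide_right_mono)

lemma nrank_mult_le:
  assumes "A \<in> carrier_mat n n" and "B \<in> carrier_mat n n"
  shows nrank_mult_le_left: "nrank n (A * B) \<le> nrank n A"
    and nrank_mult_le_right: "nrank n (A * B) \<le> nrank n B"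
  using vec_space.rank_mult_le_left[OF assms] vec_space.rank_mult_le_right[OF assms(2,1)]
  by (auto intro: nrank_mono)

lemma nrank_add_le:
  assumes "A \<in> carrier_mat n n" and "B \<in> carrier_mat n n"
  shows "nrank n (A + B) \<le> nrank n A + nrank n B"
proof -
  have "real (vec_space.rank n (A + B)) \<le> real (vec_space.rank n A) + real (vec_space.rank n B)"
    using vec_space.rank_subadditive[OF assms] by linarith
  then show ?thesis by (simp add: nrank_def add_divide_distrib[symmetric] divide_right_mono)
qed

lemma nrank_zero: "nrank n (0\<^sub>m n n) = 0"
  by (simp add: nrank_def vec_space.rank_0I)

text \<open>The inverse supplied by \<open>invertible_mat\<close> has no prescribed size; comparing
  dimensions in the two product identities forces it to be n x n.\<close>

lemma GL_set_iff:
  "A \<in> GL_set T n \<longleftrightarrow> A \<in> carrier_mat n n \<and> (\<exists>B\<in>carrier_mat n n. A * B = 1\<^sub>m n \<and> B * A = 1\<^sub>m n)"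
proof
  assume "A \<in> GL_set T n"
  then obtain B where A: "A \<in> carrier_mat n n" and AB: "A * B = 1\<^sub>m n" and BA: "B * A = 1\<^sub>m (dim_row B)"
    by (auto simp: GL_set_def invertible_mat_def inverts_mat_def)
  have "dim_col B = n" using AB by (metis index_mult_mat(3) index_one_mat(3))
  moreover have "dim_row B = n" using BA A by (metis carrier_matD(2) index_mult_mat(3) index_one_mat(3))
  ultimately show "A \<in> carrier_mat n n \<and> (\<exists>B\<in>carrier_mat n n. A * B = 1\<^sub>m n \<and> B * A = 1\<^sub>m n)"
    using A AB BA by (intro conjI bexI[of _ B]) auto
next
  assume "A \<in> carrier_mat n n \<and> (\<exists>B\<in>carrier_mat n n. A * B = 1\<^sub>m n \<and> B * A = 1\<^sub>m n)"
  then show "A \<in> GL_set T n"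
    by (auto simp: GL_set_def invertible_mat_def inverts_mat_def)
qed

lemma GL_set_carrier: "A \<in> GL_set T n \<Longrightarrow> A \<in> carrier_mat n n"
  by (simp add: GL_set_def)

lemma one_GL_set: "1\<^sub>m n \<in> GL_set T n"
  unfolding GL_set_iff by (intro conjI bexI[of _ "1\<^sub>m n"]) auto

lemma mult_GL_set:
  assumes "A \<in> GL_set T n" "B \<in> GL_set T n" shows "A * B \<in> GL_set T n"
proof -
  obtain A' B' where A: "A \<in> carrier_mat n n" "A' \<in> carrier_mat n n" "A * A' = 1\<^sub>m n" "A' * A = 1\<^sub>m n"
    and B: "B \<in> carrier_mat n n" "B' \<in> carrier_mat n n" "B * B' = 1\<^sub>m n" "B' * B = 1\<^sub>m n"
    using assms unfolding GL_set_iff by blast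
  have cancel: "(X * Y) * (Y' * X') = X * X'"
    if "X \<in> carrier_mat n n" "Y \<in> carrier_mat n n" "X' \<in> carrier_mat n n" "Y' \<in> carrier_mat n n"
      "Y * Y' = 1\<^sub>m n" for X Y X' Y' :: "'a mat"
  proof -
    have "(X * Y) * (Y' * X') = X * (Y * (Y' * X'))"
      using that by (intro assoc_mult_mat) auto
    also have "Y * (Y' * X') = (Y * Y') * X'"
      using that by (intro assoc_mult_mat[symmetric]) auto
    finally show ?thesis using that by simp
  qed
  have "(A * B) * (B' * A') = 1\<^sub>m n" "(B' * A') * (A * B) = 1\<^sub>m n"
    using cancel[of A B A' B'] cancel[of B' A' B A] A B by simp_all
  then show ?thesis
    unfolding GL_set_iff using A B by (intro conjI bexI[of _ "B' * A'"]) auto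
qed

lemma inverse_GL_set:
  assumes "A \<in> GL_set T n"
  obtains B where "B \<in> GL_set T n" "A * B = 1\<^sub>m n" "B * A = 1\<^sub>m n"
  using assms unfolding GL_set_iff by blast

lemma GL_prod_carrier: "a \<in> carrier (GL_prod T ns) \<longleftrightarrow> (\<forall>k. a k \<in> GL_set T (ns k))"
  by (simp add: GL_prod_def)

lemma GL_prod_mult: "a \<otimes>\<^bsub>GL_prod T ns\<^esub> b = (\<lambda>k. a k * b k)"
  by (simp add: GL_prod_def)

lemma GL_prod_one: "\<one>\<^bsub>GL_prod T ns\<^esub> = (\<lambda>k. 1\<^sub>m (ns k))"
  by (simp add: GL_prod_def)

lemma group_GL_prod: "group (GL_prod T ns)"
proof (rule groupI)
  fix a b c assume abc: "a \<in> carrier (GL_prod T ns)" "b \<in> carrier (GL_prod T ns)" "c \<in> carrier (GL_prod T ns)"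
  then have "a k \<in> carrier_mat (ns k) (ns k)" "b k \<in> carrier_mat (ns k) (ns k)" "c k \<in> carrier_mat (ns k) (ns k)" for k
    by (auto simp: GL_prod_carrier intro: GL_set_carrier)
  then show "a \<otimes>\<^bsub>GL_prod T ns\<^esub> b \<otimes>\<^bsub>GL_prod T ns\<^esub> c = a \<otimes>\<^bsub>GL_prod T ns\<^esub> (b \<otimes>\<^bsub>GL_prod T ns\<^esub> c)"
    by (auto simp: GL_prod_mult intro!: assoc_mult_mat)
next
  fix a assume "a \<in> carrier (GL_prod T ns)"
  then have a: "a k \<in> GL_set T (ns k)" for k by (simp add: GL_prod_carrier)
  then show "\<one>\<^bsub>GL_prod T ns\<^esub> \<otimes>\<^bsub>GL_prod T ns\<^esub> a = a"
    by (auto simp: GL_prod_mult GL_prod_one dest!: GL_set_carrier intro!: ext left_mult_one_mat)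
  have "\<forall>k. \<exists>B. B \<in> GL_set T (ns k) \<and> B * a k = 1\<^sub>m (ns k)"
    using inverse_GL_set[OF a] by metis
  then obtain b where "\<And>k. b k \<in> GL_set T (ns k) \<and> b k * a k = 1\<^sub>m (ns k)" by metis
  then show "\<exists>b\<in>carrier (GL_prod T ns). b \<otimes>\<^bsub>GL_prod T ns\<^esub> a = \<one>\<^bsub>GL_prod T ns\<^esub>"
    by (intro bexI[of _ b]) (auto simp: GL_prod_carrier GL_prod_mult GL_prod_one)
qed (auto simp: GL_prod_carrier GL_prod_mult GL_prod_one mult_GL_set one_GL_set)

lemma inv_GL_prod:
  assumes a: "a \<in> carrier (GL_prod T ns)"
  shows "(inv\<^bsub>GL_prod T ns\<^esub> a) k \<in> GL_set T (ns k)"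
    and "a k * (inv\<^bsub>GL_prod T ns\<^esub> a) k = 1\<^sub>m (ns k)"
    and "(inv\<^bsub>GL_prod T ns\<^esub> a) k * a k = 1\<^sub>m (ns k)"
proof -
  interpret group "GL_prod T ns" by (rule group_GL_prod)
  show "(inv\<^bsub>GL_prod T ns\<^esub> a) k \<in> GL_set T (ns k)"
    using inv_closed[OF a] by (simp add: GL_prod_carrier)
  show "a k * (inv\<^bsub>GL_prod T ns\<^esub> a) k = 1\<^sub>m (ns k)"
    using fun_cong[OF r_inv[OF a], of k] by (simp add: GL_prod_mult GL_prod_one)
  show "(inv\<^bsub>GL_prod T ns\<^esub> a) k * a k = 1\<^sub>m (ns k)"
    using fun_cong[OF l_inv[OF a], of k] by (simp add: GL_prod_mult GL_prod_one)
qed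

lemma tendsto_zero_of_le:
  fixes f g :: "'b \<Rightarrow> real"
  assumes "(g \<longlongrightarrow> 0) F" "\<And>x. 0 \<le> f x" "\<And>x. f x \<le> g x"
  shows "(f \<longlongrightarrow> 0) F"
  using assms(1) by (rule Lim_null_comparison[rotated]) (use assms in auto)

lemma GL_null_iff:
  "a \<in> GL_null T \<omega> ns \<longleftrightarrow> a \<in> carrier (GL_prod T ns) \<and>
     ((\<lambda>k. nrank (ns k) (a k - 1\<^sub>m (ns k))) \<longlongrightarrow> 0) \<omega>"
  by (simp add: GL_null_def)

text \<open>Multiplication does not increase rank, and a^-1 - 1 = -a^-1 (a - 1), a b - 1 = a (b - 1)
  + (a - 1), x a x^-1 - 1 = x (a - 1) x^-1.\<close>

lemma GL_null_normal: "GL_null T \<omega> ns \<lhd> GL_prod T ns"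
proof -
  let ?P = "GL_prod T ns" and ?N = "GL_null T \<omega> ns"
  interpret group ?P by (rule group_GL_prod)
  have carr: "a k \<in> carrier_mat (ns k) (ns k)" if "a \<in> carrier ?P" for a k
    using that by (auto simp: GL_prod_carrier intro: GL_set_carrier)
  have invc: "(inv\<^bsub>?P\<^esub> a) k \<in> carrier_mat (ns k) (ns k)" if "a \<in> carrier ?P" for a k
    using carr that by simp
  have "subgroup ?N ?P"
  proof (rule subgroupI)
    show "?N \<subseteq> carrier ?P" by (auto simp: GL_null_iff)
    have "\<one>\<^bsub>?P\<^esub> \<in> ?N"
      by (simp add: GL_null_iff) (simp add: GL_prod_one minus_r_inv_mat[OF one_carrier_mat] nrank_zero)
    then show "?N \<noteq> {}" by blast
  next
    fix a assume "a \<in> ?N"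
    then have a: "a \<in> carrier ?P" and lim: "((\<lambda>k. nrank (ns k) (a k - 1\<^sub>m (ns k))) \<longlongrightarrow> 0) \<omega>"
      by (auto simp: GL_null_iff)
    let ?b = "inv\<^bsub>?P\<^esub> a"
    have "((\<lambda>k. nrank (ns k) (?b k - 1\<^sub>m (ns k))) \<longlongrightarrow> 0) \<omega>"
    proof (rule tendsto_zero_of_le[OF lim nrank_nonneg])
      fix k
      note A = carr[OF a, of k] and B = invc[OF a, of k]
      have "- ?b k * (a k - 1\<^sub>m (ns k)) = - ?b k * a k - - ?b k * 1\<^sub>m (ns k)"
        using A B by (intro mult_minus_distrib_mat) auto
      also have "- ?b k * a k = - 1\<^sub>m (ns k)"
        using uminus_mult_left_mat[of "?b k" "a k"] A B inv_GL_prod(3)[OF a, of k] by simp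
      also have "- 1\<^sub>m (ns k) - - ?b k * 1\<^sub>m (ns k) = ?b k - 1\<^sub>m (ns k)"
        using B by (intro eq_matI) auto
      finally have eq: "- ?b k * (a k - 1\<^sub>m (ns k)) = ?b k - 1\<^sub>m (ns k)" .
      have "nrank (ns k) (- ?b k * (a k - 1\<^sub>m (ns k))) \<le> nrank (ns k) (a k - 1\<^sub>m (ns k))"
        using A B by (intro nrank_mult_le_right) auto
      then show "nrank (ns k) (?b k - 1\<^sub>m (ns k)) \<le> nrank (ns k) (a k - 1\<^sub>m (ns k))"
        by (simp only: eq)
    qed
    then show "?b \<in> ?N" using a by (simp add: GL_null_iff)
  next
    fix a b assume "a \<in> ?N" "b \<in> ?N"
    then have ab: "a \<in> carrier ?P" "b \<in> carrier ?P"
      and lim: "((\<lambda>k. nrank (ns k) (a k - 1\<^sub>m (ns k))) \<longlongrightarrow> 0) \<omega>"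
        "((\<lambda>k. nrank (ns k) (b k - 1\<^sub>m (ns k))) \<longlongrightarrow> 0) \<omega>"
      by (auto simp: GL_null_iff)
    have "((\<lambda>k. nrank (ns k) (a k * b k - 1\<^sub>m (ns k))) \<longlongrightarrow> 0) \<omega>"
    proof (rule tendsto_zero_of_le[OF _ nrank_nonneg])
      show "((\<lambda>k. nrank (ns k) (b k - 1\<^sub>m (ns k)) + nrank (ns k) (a k - 1\<^sub>m (ns k))) \<longlongrightarrow> 0) \<omega>"
        using tendsto_add[OF lim(2,1)] by simp
      fix k
      note A = carr[OF ab(1), of k] and B = carr[OF ab(2), of k]
      have "a k * (b k - 1\<^sub>m (ns k)) = a k * b k - a k"
        using mult_minus_distrib_mat[OF A B one_carrier_mat] A by simp
      then have "a k * b k - 1\<^sub>m (ns k) = a k * (b k - 1\<^sub>m (ns k)) + (a k - 1\<^sub>m (ns k))"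
        using A B by (intro eq_matI) auto
      then have "nrank (ns k) (a k * b k - 1\<^sub>m (ns k))
          \<le> nrank (ns k) (a k * (b k - 1\<^sub>m (ns k))) + nrank (ns k) (a k - 1\<^sub>m (ns k))"
        using A B by (simp add: nrank_add_le minus_carrier_mat)
      also have "nrank (ns k) (a k * (b k - 1\<^sub>m (ns k))) \<le> nrank (ns k) (b k - 1\<^sub>m (ns k))"
        using A B by (intro nrank_mult_le_right) auto
      finally show "nrank (ns k) (a k * b k - 1\<^sub>m (ns k))
          \<le> nrank (ns k) (b k - 1\<^sub>m (ns k)) + nrank (ns k) (a k - 1\<^sub>m (ns k))" by simp
    qed
    then show "a \<otimes>\<^bsub>?P\<^esub> b \<in> ?N"
      using m_closed[OF ab] by (simp add: GL_null_iff GL_prod_mult)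
  qed
  moreover have "x \<otimes>\<^bsub>?P\<^esub> a \<otimes>\<^bsub>?P\<^esub> inv\<^bsub>?P\<^esub> x \<in> ?N" if x: "x \<in> carrier ?P" and aN: "a \<in> ?N" for x a
  proof -
    have a: "a \<in> carrier ?P" and lim: "((\<lambda>k. nrank (ns k) (a k - 1\<^sub>m (ns k))) \<longlongrightarrow> 0) \<omega>"
      using aN by (auto simp: GL_null_iff)
    let ?y = "inv\<^bsub>?P\<^esub> x"
    have "((\<lambda>k. nrank (ns k) (x k * a k * ?y k - 1\<^sub>m (ns k))) \<longlongrightarrow> 0) \<omega>"
    proof (rule tendsto_zero_of_le[OF lim nrank_nonneg])
      fix k
      note X = carr[OF x, of k] and A = carr[OF a, of k] and Y = invc[OF x, of k]
      have "x k * (a k - 1\<^sub>m (ns k)) = x k * a k - x k"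
        using mult_minus_distrib_mat[OF X A one_carrier_mat] X by simp
      then have "x k * (a k - 1\<^sub>m (ns k)) * ?y k = x k * a k * ?y k - x k * ?y k"
        using minus_mult_distrib_mat[OF mult_carrier_mat[OF X A] X Y] by simp
      then have "x k * a k * ?y k - 1\<^sub>m (ns k) = x k * (a k - 1\<^sub>m (ns k)) * ?y k"
        using inv_GL_prod(2)[OF x, of k] by simp
      also have "nrank (ns k) \<dots> \<le> nrank (ns k) (x k * (a k - 1\<^sub>m (ns k)))"
        using X A Y by (intro nrank_mult_le_left) auto
      also have "\<dots> \<le> nrank (ns k) (a k - 1\<^sub>m (ns k))"
        using X A by (intro nrank_mult_le_right) auto
      finally show "nrank (ns k) (x k * a k * ?y k - 1\<^sub>m (ns k)) \<le> nrank (ns k) (a k - 1\<^sub>m (ns k))" .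
    qed
    then show ?thesis
      using x a m_closed inv_closed by (simp add: GL_null_iff) (simp add: GL_prod_mult)
  qed
  ultimately show ?thesis unfolding normal_inv_iff by blast
qed

text \<open>With h = a b^-1 one has a - b = (h - 1) b and h - 1 = (a - b) b^-1, so both differences
  have the same rank.\<close>

lemma GL_null_coset_eq_iff:
  assumes a: "a \<in> carrier (GL_prod T ns)" and b: "b \<in> carrier (GL_prod T ns)"
  shows "GL_null T \<omega> ns #>\<^bsub>GL_prod T ns\<^esub> a = GL_null T \<omega> ns #>\<^bsub>GL_prod T ns\<^esub> b
    \<longleftrightarrow> ((\<lambda>k. nrank (ns k) (a k - b k)) \<longlongrightarrow> 0) \<omega>"
proof -
  let ?P = "GL_prod T ns" and ?N = "GL_null T \<omega> ns"
  interpret group ?P by (rule group_GL_prod)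
  interpret N: normal ?N ?P by (rule GL_null_normal)
  have carr: "c k \<in> carrier_mat (ns k) (ns k)" if "c \<in> carrier ?P" for c k
    using that by (auto simp: GL_prod_carrier intro: GL_set_carrier)
  define h where "h = a \<otimes>\<^bsub>?P\<^esub> inv\<^bsub>?P\<^esub> b"
  have h: "h \<in> carrier ?P" using a b by (simp add: h_def)
  have hb: "a = h \<otimes>\<^bsub>?P\<^esub> b" using a b by (simp add: h_def m_assoc)
  have diff: "a k - b k = (h k - 1\<^sub>m (ns k)) * b k" for k
    using minus_mult_distrib_mat[OF carr[OF h] one_carrier_mat carr[OF b], of k] carr[OF b, of k]
      fun_cong[OF hb, of k] by (simp add: GL_prod_mult)
  have diff': "h k - 1\<^sub>m (ns k) = (a k - b k) * (inv\<^bsub>?P\<^esub> b) k" for k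
    using minus_mult_distrib_mat[OF carr[OF a] carr[OF b] carr[OF inv_closed[OF b]], of k]
      inv_GL_prod(2)[OF b, of k] by (simp add: h_def GL_prod_mult)
  have le: "nrank (ns k) (a k - b k) \<le> nrank (ns k) (h k - 1\<^sub>m (ns k))" for k
    unfolding diff using carr[OF h, of k] carr[OF b, of k] by (intro nrank_mult_le_left) auto
  have le': "nrank (ns k) (h k - 1\<^sub>m (ns k)) \<le> nrank (ns k) (a k - b k)" for k
    unfolding diff' using carr[OF a, of k] carr[OF b, of k] carr[OF inv_closed[OF b], of k]
    by (intro nrank_mult_le_left) auto
  have "?N #>\<^bsub>?P\<^esub> a = ?N #>\<^bsub>?P\<^esub> b \<longleftrightarrow> a \<in> ?N #>\<^bsub>?P\<^esub> b"
    using repr_independence[OF _ b N.subgroup_axioms] rcos_self[OF a N.subgroup_axioms] by metis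
  also have "\<dots> \<longleftrightarrow> h \<in> ?N"
  proof
    assume "a \<in> ?N #>\<^bsub>?P\<^esub> b"
    then obtain n where n: "n \<in> ?N" "a = n \<otimes>\<^bsub>?P\<^esub> b" by (auto simp: r_coset_def)
    then have "n = h" using b N.subset by (auto simp: h_def m_assoc)
    then show "h \<in> ?N" using n by simp
  next
    assume "h \<in> ?N"
    then show "a \<in> ?N #>\<^bsub>?P\<^esub> b" using hb by (auto simp: r_coset_def)
  qed
  also have "\<dots> \<longleftrightarrow> ((\<lambda>k. nrank (ns k) (a k - b k)) \<longlongrightarrow> 0) \<omega>"
    using h tendsto_zero_of_le[OF _ nrank_nonneg le] tendsto_zero_of_le[OF _ nrank_nonneg le']
    by (auto simp: GL_null_iff)
  finally show ?thesis .
qed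

text \<open>Expresses the morphism law through ranks of differences of representatives. It is used
  once to unpack the given embedding and once to build the rational one.\<close>

lemma GL_ultra_hom_iff:
  assumes a: "\<And>g. g \<in> carrier G \<Longrightarrow> a g \<in> carrier (GL_prod T ns)" and G: "group G"
  shows "(\<lambda>g. GL_null T \<omega> ns #>\<^bsub>GL_prod T ns\<^esub> a g) \<in> hom G (GL_ultra T \<omega> ns) \<longleftrightarrow>
    (\<forall>g\<in>carrier G. \<forall>h\<in>carrier G. ((\<lambda>k. nrank (ns k) (a g k * a h k - a (g \<otimes>\<^bsub>G\<^esub> h) k)) \<longlongrightarrow> 0) \<omega>)"
proof -
  let ?P = "GL_prod T ns" and ?N = "GL_null T \<omega> ns"
  interpret group ?P by (rule group_GL_prod)
  interpret N: normal ?N ?P by (rule GL_null_normal)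
  interpret G: group G by (rule G)
  have "?N #>\<^bsub>?P\<^esub> a (g \<otimes>\<^bsub>G\<^esub> h) = (?N #>\<^bsub>?P\<^esub> a g) <#>\<^bsub>?P\<^esub> (?N #>\<^bsub>?P\<^esub> a h) \<longleftrightarrow>
      ((\<lambda>k. nrank (ns k) (a g k * a h k - a (g \<otimes>\<^bsub>G\<^esub> h) k)) \<longlongrightarrow> 0) \<omega>"
    if gh: "g \<in> carrier G" "h \<in> carrier G" for g h
    using GL_null_coset_eq_iff[OF m_closed[OF a[OF gh(1)] a[OF gh(2)]] a[OF G.m_closed[OF gh]]]
    unfolding N.rcos_sum[OF a[OF gh(1)] a[OF gh(2)]] by (auto simp: GL_prod_mult)
  then show ?thesis
    using rcosetsI[OF N.subset a] by (auto simp: hom_def GL_ultra_def FactGroup_def)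
qed

section \<open>Transport of an embedding from a field of characteristic zero to the
  rationals\<close>

lemma linear_sofic_over_rationals:
  fixes G :: "('g, 'b) monoid_scheme" and T :: "'a::field_char_0 itself"
  assumes G: "group G" and count: "countable (carrier G)"
    and \<omega>: "nonprincipal_ultrafilter \<omega>" and ns: "filterlim ns at_top sequentially"
    and hom: "\<Theta> \<in> hom G (GL_ultra T \<omega> ns)" and inj: "inj_on \<Theta> (carrier G)"
  shows "\<exists>ms \<Psi>. filterlim ms at_top sequentially \<and> \<Psi> \<in> hom G (GL_ultra TYPE(rat) \<omega> ms)
    \<and> inj_on \<Psi> (carrier G)"
proof -
  interpret G: group G by (rule G)
  let ?P = "GL_prod T ns" and ?N = "GL_null T \<omega> ns"
  have "\<Theta> g \<in> rcosets\<^bsub>?P\<^esub> ?N" if "g \<in> carrier G" for g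
    using hom that by (auto simp: hom_def GL_ultra_def FactGroup_def)
  then have "\<forall>g\<in>carrier G. \<exists>a\<in>carrier ?P. \<Theta> g = ?N #>\<^bsub>?P\<^esub> a"
    unfolding RCOSETS_def by blast
  then obtain a where a: "\<And>g. g \<in> carrier G \<Longrightarrow> a g \<in> carrier ?P"
    and \<Theta>: "\<And>g. g \<in> carrier G \<Longrightarrow> \<Theta> g = ?N #>\<^bsub>?P\<^esub> a g" by metis
  have "(\<lambda>g. ?N #>\<^bsub>?P\<^esub> a g) \<in> hom G (GL_ultra T \<omega> ns)"
    using hom by (simp add: hom_def Pi_iff \<Theta>[symmetric])
  then have a_hom: "\<forall>g\<in>carrier G. \<forall>h\<in>carrier G.
      ((\<lambda>k. nrank (ns k) (a g k * a h k - a (g \<otimes>\<^bsub>G\<^esub> h) k)) \<longlongrightarrow> 0) \<omega>"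
    by (rule iffD1[OF GL_ultra_hom_iff, rotated 2]) (auto intro: a G)
  have a_mult: "((\<lambda>k. nrank (ns k) (a g k * a h k - a (g \<otimes>\<^bsub>G\<^esub> h) k)) \<longlongrightarrow> 0) \<omega>"
    if "g \<in> carrier G" "h \<in> carrier G" for g h
    using a_hom that by (elim ballE) auto
  have a_inj: "g = h" if "g \<in> carrier G" "h \<in> carrier G" "((\<lambda>k. nrank (ns k) (a g k - a h k)) \<longlongrightarrow> 0) \<omega>" for g h
  proof -
    have "\<Theta> g = \<Theta> h"
      unfolding \<Theta>[OF that(1)] \<Theta>[OF that(2)]
      by (rule iffD2[OF GL_null_coset_eq_iff[OF a[OF that(1)] a[OF that(2)]] that(3)])
    then show ?thesis using inj that(1,2) by (simp add: inj_on_eq_iff)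
  qed
  \<comment> \<open>The inverses are recorded because their block images certify that the block
    images of \<open>a g k\<close> are invertible.\<close>
  define c where "c g = inv\<^bsub>?P\<^esub> (a g)" for g
  have ac: "a g k \<in> carrier_mat (ns k) (ns k)" "c g k \<in> carrier_mat (ns k) (ns k)"
    "a g k * c g k = 1\<^sub>m (ns k)" "c g k * a g k = 1\<^sub>m (ns k)" if "g \<in> carrier G" for g k
    using a[OF that] inv_GL_prod[OF a[OF that], of k]
    by (auto simp: c_def GL_prod_carrier intro: GL_set_carrier)
  define E where "E k = {g \<in> carrier G. to_nat_on (carrier G) g \<le> k}" for k
  have "finite (E k)" for k
    by (rule inj_on_finite[of "to_nat_on (carrier G)" _ "{..k}"])
      (auto simp: E_def intro: inj_on_subset[OF inj_on_to_nat_on[OF count]])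
  \<comment> \<open>Each group element lies in all but finitely many of the finite windows
    \<open>E k\<close>; a non-principal ultrafilter contains every cofinite set.\<close>
  have E_ev: "eventually (\<lambda>k. g \<in> E k) \<omega>" if "g \<in> carrier G" for g
  proof -
    have "eventually (\<lambda>k. g \<in> E k) sequentially"
      using eventually_ge_at_top[of "to_nat_on (carrier G) g"] that by (auto simp: E_def elim: eventually_mono)
    then show ?thesis
      using \<omega> unfolding nonprincipal_ultrafilter_def cofinite_eq_sequentially by (auto dest: filter_leD)
  qed
  \<comment> \<open>The first two families put all entries of \<open>a g k\<close> and its inverse
    into the ring, the third controls injectivity, and the fourth, with \<open>j\<close> taken to be
    the product of \<open>g\<close> and \<open>h\<close>, the morphism law.\<close>
  define M where "M k = (\<lambda>g. a g k) ` E k \<union> (\<lambda>g. c g k) ` E k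
      \<union> (\<lambda>(g,h). a g k - a h k) ` (E k \<times> E k)
      \<union> (\<lambda>(g,h,j). a g k * a h k - a j k) ` (E k \<times> E k \<times> E k)" for k
  have "finite (M k)" for k using \<open>finite (E k)\<close> by (simp add: M_def)
  moreover have "M k \<subseteq> carrier_mat (ns k) (ns k)" for k
    using ac(1,2) by (auto simp: M_def E_def intro!: minus_carrier_mat)
  ultimately have "\<forall>k. \<exists>R d (\<phi> :: 'a \<Rightarrow> rat mat). mat_rep R d \<phi> \<and> M k \<subseteq> mat_over R (ns k) (ns k) \<and>
    (\<forall>A\<in>M k. vec_space.rank (ns k * d) (block_mat \<phi> d A) = vec_space.rank (ns k) A * d)"
    by (intro allI finite_matrices_rational_model)
  then obtain R d and \<phi> :: "nat \<Rightarrow> 'a \<Rightarrow> rat mat" where rep: "\<And>k. mat_rep (R k) (d k) (\<phi> k)"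
    and over: "\<And>k. M k \<subseteq> mat_over (R k) (ns k) (ns k)"
    and rank: "\<And>k A. A \<in> M k \<Longrightarrow>
      vec_space.rank (ns k * d k) (block_mat (\<phi> k) (d k) A) = vec_space.rank (ns k) A * d k"
    unfolding choice_iff by blast
  define ms where "ms k = ns k * d k" for k
  define B where "B k = block_mat (\<phi> k) (d k)" for k
  \<comment> \<open>The identity is a default outside the window: it keeps \<open>b g k\<close>
    invertible at every level and occurs at finitely many \<open>k\<close> only for each
    \<open>g\<close>.\<close>
  define b where "b g k = (if g \<in> E k then B k (a g k) else 1\<^sub>m (ms k))" for g k
  \<comment> \<open>The factor \<open>d k\<close> cancels because it is positive; if
    \<open>ns k = 0\<close>, both sides are 0 by division by zero.\<close>
  have nrank_B: "nrank (ms k) (B k A) = nrank (ns k) A" if "A \<in> M k" for k A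
    using rank[OF that] mat_rep_pos[OF rep, of k] by (simp add: nrank_def ms_def B_def)
  have over_ac: "a g k \<in> mat_over (R k) (ns k) (ns k)" "c g k \<in> mat_over (R k) (ns k) (ns k)"
    if "g \<in> E k" for g k
    using that over[of k] by (auto simp: M_def)
  let ?P' = "GL_prod TYPE(rat) ms" and ?N' = "GL_null TYPE(rat) \<omega> ms"
  have b: "b g \<in> carrier ?P'" if g: "g \<in> carrier G" for g
  proof -
    have "b g k \<in> GL_set TYPE(rat) (ms k)" for k
    proof (cases "g \<in> E k")
      case True
      note o = over_ac[OF True]
      have "B k (a g k) * B k (c g k) = 1\<^sub>m (ms k)" "B k (c g k) * B k (a g k) = 1\<^sub>m (ms k)"
        unfolding B_def ms_def block_mat_mult[OF rep o, symmetric]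
          block_mat_mult[OF rep o(2,1), symmetric] ac(3,4)[OF g]
        by (rule block_mat_one[OF rep])+
      moreover have "B k (a g k) \<in> carrier_mat (ms k) (ms k)" "B k (c g k) \<in> carrier_mat (ms k) (ms k)"
        unfolding B_def ms_def using ac(1,2)[OF g] by (auto intro: block_mat_carrier)
      ultimately show ?thesis unfolding GL_set_iff using True by (auto simp: b_def)
    qed (simp add: b_def one_GL_set)
    then show ?thesis by (simp add: GL_prod_carrier)
  qed
  have b_mult: "((\<lambda>k. nrank (ms k) (b g k * b h k - b (g \<otimes>\<^bsub>G\<^esub> h) k)) \<longlongrightarrow> 0) \<omega>"
    if gh: "g \<in> carrier G" "h \<in> carrier G" for g h
  proof (rule Lim_transform_eventually[OF a_mult[OF gh]])
    let ?j = "g \<otimes>\<^bsub>G\<^esub> h"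
    have "eventually (\<lambda>k. g \<in> E k \<and> h \<in> E k \<and> ?j \<in> E k) \<omega>"
      using gh by (intro eventually_conj E_ev) auto
    then show "eventually (\<lambda>k. nrank (ns k) (a g k * a h k - a ?j k)
        = nrank (ms k) (b g k * b h k - b ?j k)) \<omega>"
    proof (rule eventually_mono)
      fix k assume k: "g \<in> E k \<and> h \<in> E k \<and> ?j \<in> E k"
      have o: "a g k \<in> mat_over (R k) (ns k) (ns k)" "a h k \<in> mat_over (R k) (ns k) (ns k)"
        "a ?j k \<in> mat_over (R k) (ns k) (ns k)"
        using over_ac k by auto
      note p = mult_mat_over[OF mat_rep_subring[OF rep] o(1,2)]
      have "b g k * b h k - b ?j k = B k (a g k * a h k - a ?j k)"
        using k block_mat_diff[OF rep p o(3)] block_mat_mult[OF rep o(1,2)] by (simp add: b_def B_def)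
      moreover have "a g k * a h k - a ?j k \<in> M k"
        unfolding M_def by (rule UnI2, rule image_eqI[where x = "(g, h, ?j)"]) (use k in simp_all)
      ultimately show "nrank (ns k) (a g k * a h k - a ?j k) = nrank (ms k) (b g k * b h k - b ?j k)"
        by (simp add: nrank_B)
    qed
  qed
  \<comment> \<open>The comparison runs backwards here: a vanishing limit for the rational matrices
    gives one for the original matrices, where injectivity of \<open>\<Theta>\<close>
    applies.\<close>
  have b_inj: "g = h" if gh: "g \<in> carrier G" "h \<in> carrier G"
    and lim: "((\<lambda>k. nrank (ms k) (b g k - b h k)) \<longlongrightarrow> 0) \<omega>" for g h
  proof (rule a_inj[OF gh Lim_transform_eventually[OF lim]])
    have "eventually (\<lambda>k. g \<in> E k \<and> h \<in> E k) \<omega>"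
      using gh by (intro eventually_conj E_ev) auto
    then show "eventually (\<lambda>k. nrank (ms k) (b g k - b h k) = nrank (ns k) (a g k - a h k)) \<omega>"
    proof (rule eventually_mono)
      fix k assume k: "g \<in> E k \<and> h \<in> E k"
      have "b g k - b h k = B k (a g k - a h k)"
        using k block_mat_diff[OF rep over_ac(1) over_ac(1), of g k h] by (simp add: b_def B_def)
      moreover have "a g k - a h k \<in> M k"
        unfolding M_def by (rule UnI1, rule UnI2, rule image_eqI[where x = "(g, h)"]) (use k in simp_all)
      ultimately show "nrank (ms k) (b g k - b h k) = nrank (ns k) (a g k - a h k)"
        by (simp add: nrank_B)
    qed
  qed
  have "ns k \<le> ms k" for k using mat_rep_pos[OF rep, of k] by (simp add: ms_def)
  then have "filterlim ms at_top sequentially"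
    using filterlim_at_top_mono[OF ns] by simp
  moreover have "(\<lambda>g. ?N' #>\<^bsub>?P'\<^esub> b g) \<in> hom G (GL_ultra TYPE(rat) \<omega> ms)"
    by (intro iffD2[OF GL_ultra_hom_iff[OF b G]] ballI b_mult)
  moreover have "inj_on (\<lambda>g. ?N' #>\<^bsub>?P'\<^esub> b g) (carrier G)"
    by (intro inj_onI b_inj iffD1[OF GL_null_coset_eq_iff[OF b b]])
  ultimately show ?thesis by blast
qed

theorem mainTheorem9:
  fixes G :: "('g, 'b) monoid_scheme"
  assumes "group G" and "countable (carrier G)" and "linear_sofic G"
  shows "\<exists>\<omega> ns \<Theta>. nonprincipal_ultrafilter \<omega> \<and> filterlim ns at_top sequentially
      \<and> \<Theta> \<in> hom G (GL_ultra TYPE(rat) \<omega> ns) \<and> inj_on \<Theta> (carrier G)"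
proof -
  obtain \<omega> ns \<Theta> where "nonprincipal_ultrafilter \<omega>" "filterlim ns at_top sequentially"
    "\<Theta> \<in> hom G (GL_ultra TYPE(complex) \<omega> ns)" "inj_on \<Theta> (carrier G)"
    using assms(3) by (auto simp: linear_sofic_def)
  with linear_sofic_over_rationals[OF assms(1,2) this] show ?thesis by blast
qed

end
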